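(* In the network setting of the context, let $r$ be the running cost with $m\ge1$ and strictly positive vectors $\xi\in(0,\infty)^I$, $\zeta\in(0,\infty)^J$. Then there exist $\delta>0$ and $\tilde C>0$ such that Hypothesis A holds (with $d=I$) for the cost $r$, with $\mathcal K=\mathcal K_\delta:=\{x\in\mathbb R^I:|e\cdot x|>\delta|x|\}$ and $h(x,u)=\tilde C|x|^m$.
   Context: Network setting. $\mathcal I=\{1,\dots,I\}$, $\mathcal J=\{1,\dots,J\}$; $\mathcal G$ a bipartite tree on $\mathcal I\cup\mathcal J$ with edges $i\sim j$; $\mathcal J(i)=\{j:i\sim j\}$. Constants $\lambda_i>0$, $\gamma_i\ge0$, $\ell_i\in\mathbb R$; $\mu_{ij}>0$ if $i\sim j$, $\mu_{ij}=0$ otherwise. $e$ = all-ones vector, $a^\pm$ positive/negative parts. For $e\cdot\alpha=e\cdot\beta$, $G(\alpha,\beta)$ is the unique $\psi\in\mathbb R^{I\times J}$ with row sums $\alpha_i$, column sums $\beta_j$, and $\psi_{ij}=0$ for $i\not\sim j$. $\mathbb U=\{u=(u^c,u^s)\in\mathbb R^I_+\times\mathbb R^J_+:e\cdot u^c=e\cdot u^s=1\}$; $\hat G[u](x)=G(x-(e\cdot x)^+u^c,-(e\cdot x)^-u^s)$; drift $b_i(x,u)=-\sum_{j\in\mathcal J(i)}\mu_{ij}\hat G_{ij}[u](x)-\gamma_i(e\cdot x)^+u^c_i+\ell_i$. Controlled diffusion $dX_t=b(X_t,U_t)dt+\Sigma dW_t$ with $\Sigma=\operatorname{diag}(\sqrt{2\lambda_1},\dots,\sqrt{2\lambda_I})$;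 controlled generator $\mathcal L^u f(x)=\sum_i\lambda_i\partial_{ii}f(x)+b(x,u)\cdot\nabla f(x)$. Running cost: $r(x,u)=[(e\cdot x)^+]^m\sum_{i=1}^I\xi_i(u^c_i)^m+[(e\cdot x)^-]^m\sum_{j=1}^J\zeta_j(u^s_j)^m$. Hypothesis A (for a cost $r$, dimension $d$): there is an open $\mathcal K\subset\mathbb R^d$ such that (i) $\bar{\mathcal K}\cap\{x:\min_u r(x,u)\le c\}$ is compact for every $c\in\mathbb R$; (ii) there exist nonnegative functions $\mathcal V\in C^2(\mathbb R^d)$ and $h\in C(\mathbb R^d\times\mathbb U)$, both inf-compact (i.e. $\{x:\min_u h(x,u)\le c\}$ and $\{x:\mathcal V(x)\le c\}$ compact for all $c$), with $\mathcal L^u\mathcal V(x)\le1-h(x,u)$ for all $(x,u)\in\mathcal K^c\times\mathbb U$ and $\mathcal L^u\mathcal V(x)\le1+r(x,u)$ for all $(x,u)\in\mathcal K\times\mathbb U$. *)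

theory Defs
  imports "HOL-Analysis.Analysis"
begin

text \<open>Index sets: the server classes are a finite type 'i (I = CARD('i)),
  the server pools a finite type 'j (J = CARD('j)). States x live in real^'i.
  The edge relation of the bipartite graph is adj :: 'i => 'j => bool.\<close>

definition pospart :: "real \<Rightarrow> real" where "pospart a = max a 0"
definition negpart :: "real \<Rightarrow> real" where "negpart a = max (- a) 0"

definition esum :: "real ^ 'i \<Rightarrow> real" where "esum x = (\<Sum>i\<in>UNIV. x $ i)"

text \<open>The bipartite graph on I \<union> J is a tree: connected and #edges = #vertices - 1.\<close>
definition graph_edges :: "('i \<Rightarrow> 'j \<Rightarrow> bool) \<Rightarrow> ('i + 'j) rel" where
  "graph_edges adj = {(Inl i, Inr j) | i j. adj i j} \<union> {(Inr j, Inl i) | i j. adj i j}"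

definition bip_tree :: "('i::finite \<Rightarrow> 'j::finite \<Rightarrow> bool) \<Rightarrow> bool" where
  "bip_tree adj \<longleftrightarrow> (\<forall>a b. (a, b) \<in> (graph_edges adj)\<^sup>*)
      \<and> card {(i, j). adj i j} + 1 = CARD('i) + CARD('j)"

text \<open>G(alpha, beta): the unique matrix with given row/column sums supported on the edges.\<close>
definition Gmat :: "('i::finite \<Rightarrow> 'j::finite \<Rightarrow> bool) \<Rightarrow> ('i \<Rightarrow> real) \<Rightarrow> ('j \<Rightarrow> real) \<Rightarrow> 'i \<Rightarrow> 'j \<Rightarrow> real" where
  "Gmat adj \<alpha> \<beta> = (THE \<psi>. (\<forall>i. (\<Sum>j\<in>UNIV. \<psi> i j) = \<alpha> i) \<and> (\<forall>j. (\<Sum>i\<in>UNIV. \<psi> i j) = \<beta> j)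
       \<and> (\<forall>i j. \<not> adj i j \<longrightarrow> \<psi> i j = 0))"

text \<open>Action space U; a control u = (u^c, u^s).\<close>
definition Uset :: "(('i::finite \<Rightarrow> real) \<times> ('j::finite \<Rightarrow> real)) set" where
  "Uset = {u. (\<forall>i. fst u i \<ge> 0) \<and> (\<forall>j. snd u j \<ge> 0) \<and> (\<Sum>i\<in>UNIV. fst u i) = 1 \<and> (\<Sum>j\<in>UNIV. snd u j) = 1}"

definition Ghat :: "('i::finite \<Rightarrow> 'j::finite \<Rightarrow> bool) \<Rightarrow> ('i \<Rightarrow> real) \<times> ('j \<Rightarrow> real) \<Rightarrow> real ^ 'i \<Rightarrow> 'i \<Rightarrow> 'j \<Rightarrow> real" where
  "Ghat adj u x = Gmat adj (\<lambda>i. x $ i - pospart (esum x) * fst u i) (\<lambda>j. - negpart (esum x) * snd u j)"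

definition drift :: "('i::finite \<Rightarrow> 'j::finite \<Rightarrow> bool) \<Rightarrow> ('i \<Rightarrow> 'j \<Rightarrow> real) \<Rightarrow> ('i \<Rightarrow> real) \<Rightarrow> ('i \<Rightarrow> real)
     \<Rightarrow> real ^ 'i \<Rightarrow> ('i \<Rightarrow> real) \<times> ('j \<Rightarrow> real) \<Rightarrow> real ^ 'i" where
  "drift adj \<mu> \<gamma> ell x u = (\<chi> i. - (\<Sum>j\<in>{j. adj i j}. \<mu> i j * Ghat adj u x i j)
       - \<gamma> i * pospart (esum x) * fst u i + ell i)"

text \<open>Running cost r(x,u).\<close>
definition cost :: "real \<Rightarrow> ('i::finite \<Rightarrow> real) \<Rightarrow> ('j::finite \<Rightarrow> real) \<Rightarrow> real ^ 'i
     \<Rightarrow> ('i \<Rightarrow> real) \<times> ('j \<Rightarrow> real) \<Rightarrow> real" where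
  "cost m \<xi> \<zeta> x u = (pospart (esum x)) powr m * (\<Sum>i\<in>UNIV. \<xi> i * (fst u i) powr m)
     + (negpart (esum x)) powr m * (\<Sum>j\<in>UNIV. \<zeta> j * (snd u j) powr m)"

text \<open>Controlled generator applied to a C^2 function V with gradient g and Hessian H:
  L^u V(x) = sum_i lambda_i d_ii V(x) + b(x,u) . grad V(x).\<close>
definition gen :: "(real ^ 'i \<Rightarrow> ('i::finite \<Rightarrow> real) \<times> ('j \<Rightarrow> real) \<Rightarrow> real ^ 'i) \<Rightarrow> ('i \<Rightarrow> real)
     \<Rightarrow> (real ^ 'i \<Rightarrow> real ^ 'i) \<Rightarrow> (real ^ 'i \<Rightarrow> real ^ 'i ^ 'i)
     \<Rightarrow> real ^ 'i \<Rightarrow> ('i \<Rightarrow> real) \<times> ('j \<Rightarrow> real) \<Rightarrow> real" where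
  "gen b lam g H x u = (\<Sum>i\<in>UNIV. lam i * (H x $ i $ i)) + b x u \<bullet> g x"

text \<open>V is C^2 on R^I with gradient g and Hessian H (H continuous).\<close>
definition C2_with :: "(real ^ 'i::finite \<Rightarrow> real) \<Rightarrow> (real ^ 'i \<Rightarrow> real ^ 'i) \<Rightarrow> (real ^ 'i \<Rightarrow> real ^ 'i ^ 'i) \<Rightarrow> bool" where
  "C2_with V g H \<longleftrightarrow> (\<forall>x. (V has_derivative (\<lambda>v. g x \<bullet> v)) (at x))
     \<and> (\<forall>x. (g has_derivative (\<lambda>v. H x *v v)) (at x)) \<and> continuous_on UNIV H"

text \<open>Hypothesis A for cost r, drift b, diffusion coefficients lambda, with given K and h.\<close>
definition hypA :: "(real ^ 'i \<Rightarrow> ('i::finite \<Rightarrow> real) \<times> ('j::finite \<Rightarrow> real) \<Rightarrow> real ^ 'i) \<Rightarrow> ('i \<Rightarrow> real)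
     \<Rightarrow> (real ^ 'i \<Rightarrow> ('i \<Rightarrow> real) \<times> ('j \<Rightarrow> real) \<Rightarrow> real)
     \<Rightarrow> (real ^ 'i) set \<Rightarrow> (real ^ 'i \<Rightarrow> ('i \<Rightarrow> real) \<times> ('j \<Rightarrow> real) \<Rightarrow> real) \<Rightarrow> bool" where
  "hypA b lam r K h \<longleftrightarrow> open K
     \<and> (\<forall>c::real. compact (closure K \<inter> {x. (INF u\<in>Uset. r x u) \<le> c}))
     \<and> (\<exists>V g H. C2_with V g H \<and> (\<forall>x. V x \<ge> 0)
          \<and> (\<forall>x u. u \<in> Uset \<longrightarrow> h x u \<ge> 0)
          \<and> continuous_on (UNIV \<times> Uset) (\<lambda>(x, u). h x u)
          \<and> (\<forall>c::real. compact {x. (INF u\<in>Uset. h x u) \<le> c})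
          \<and> (\<forall>c::real. compact {x. V x \<le> c})
          \<and> (\<forall>x u. x \<notin> K \<longrightarrow> u \<in> Uset \<longrightarrow> gen b lam g H x u \<le> 1 - h x u)
          \<and> (\<forall>x u. x \<in> K \<longrightarrow> u \<in> Uset \<longrightarrow> gen b lam g H x u \<le> 1 + r x u))"

end

(* Write psi for the matrix G(alpha, beta). The dissipativity estimate
     sum_i q_i alpha_i sum_j mu_ij psi_ij >= kappa |psi|^2 - C |beta|^2
   holds for a suitable positive weight q on the rows, by growing the tree one leaf at a time;
   it also yields the uniqueness of G. Since beta = O(|e.x|) and alpha = x + O(|e.x|), the drift
   satisfies sum_i q_i x_i b_i <= -a |x|^2 + K |x| |e.x| + K |x| uniformly in the control. Hence
   V = eps (1 + sum_i q_i x_i^2)^(m/2) has L^u V <= 1 - C |x|^m where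
   |e.x| <= delta |x|, for small delta. Where |e.x| > delta |x|, the cost
   r >= c |e.x|^m >= c delta^m |x|^m dominates L^u V = O(eps (1 + |x|^m)) once eps is small. *)
theory Submission
  imports Defs
begin

text \<open>A row with two or more edges can have row sum zero without being zero, so the form in
  the estimate is not coercive in psi by itself; the penalty C |beta|^2 on the column sums makes up
  for this. It is affordable because the column sums of the drift matrix are those of
  \<open>- (e.x)^- u^s\<close>, of norm at most |e.x|. The weights q depend on the order of growth:
  the weight of a new row is fixed by the constants C and \<kappa> accumulated before it. The
  estimate controls |psi|^2 and not merely |alpha|^2. The surplus pays for testing the drift with
  q_i x_i in place of q_i alpha_i, and Cauchy-Schwarz along the rows recovers |alpha|^2 from
  |psi|^2. The slope \<delta> is fixed by the drift constants a and K alone. Since V is linear in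
  eps, eps is chosen last, and \<open>h\<close> is scaled together with it.\<close>

subsection \<open>Bipartite trees grown leaf by leaf\<close>

text \<open>Column leaves and row leaves are separate rules because they enter the quadratic
  estimate in opposite ways. \<open>T\<close> records the edges used so far, so that the support of
  a matrix can shrink along with the tree.\<close>

inductive grown :: "('i \<Rightarrow> 'j \<Rightarrow> bool) \<Rightarrow> ('i + 'j) set \<Rightarrow> ('i \<times> 'j) set \<Rightarrow> bool"
  for adj where
  root: "grown adj {v} {}"
| col: "grown adj S T \<Longrightarrow> Inl i \<in> S \<Longrightarrow> Inr j \<notin> S \<Longrightarrow> adj i j \<Longrightarrow>
    grown adj (insert (Inr j) S) (insert (i, j) T)"
| row: "grown adj S T \<Longrightarrow> Inr j \<in> S \<Longrightarrow> Inl i \<notin> S \<Longrightarrow> adj i j \<Longrightarrow>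
    grown adj (insert (Inl i) S) (insert (i, j) T)"

lemma grown_edge:
  assumes "grown adj S T" "(i, j) \<in> T"
  shows "Inl i \<in> S" "Inr j \<in> S" "adj i j"
  using assms by (induction) auto

lemma grown_nonempty: "grown adj S T \<Longrightarrow> S \<noteq> {}"
  by (induction rule: grown.induct) auto

text \<open>Both ends of an old edge lie in \<open>S\<close>, so the edge to a fresh vertex is
  always new.\<close>

lemma grown_card:
  fixes adj :: "'i::finite \<Rightarrow> 'j::finite \<Rightarrow> bool"
  assumes "grown adj S T"
  shows "card S = card T + 1"
  using assms
proof (induction rule: grown.induct)
  case (col S T i j)
  then have "(i, j) \<notin> T" using grown_edge by metis
  then show ?case using col by simp
next
  case (row S T j i)
  then have "(i, j) \<notin> T" using grown_edge by metis
  then show ?case using row by simp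
qed simp

lemma rtrancl_exit:
  assumes "(a, b) \<in> R\<^sup>*" "a \<in> S" "b \<notin> S"
  obtains c d where "(c, d) \<in> R" "c \<in> S" "d \<notin> S"
  using assms by (induction rule: rtrancl_induct) auto

text \<open>Connectivity supplies an edge leaving any proper nonempty \<open>S\<close>, so the
  growth never stalls. At the end \<open>T\<close> has I + J - 1 elements, as many as the edge set
  containing it, hence equals it. Counting edges replaces any argument about cycles.\<close>

lemma bip_tree_grown:
  fixes adj :: "'i::finite \<Rightarrow> 'j::finite \<Rightarrow> bool"
  assumes "bip_tree adj"
  shows "grown adj UNIV {(i, j). adj i j}"
proof -
  have step: "\<exists>S' T'. grown adj S' T' \<and> card S' = Suc (card S)"
    if g: "grown adj S T" and "S \<noteq> UNIV" for S T
  proof -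
    obtain a b where "a \<in> S" "b \<notin> S" using grown_nonempty[OF g] \<open>S \<noteq> UNIV\<close> by blast
    moreover have "(a, b) \<in> (graph_edges adj)\<^sup>*" using assms by (simp add: bip_tree_def)
    ultimately obtain c d where cd: "(c, d) \<in> graph_edges adj" "c \<in> S" "d \<notin> S"
      by (blast elim: rtrancl_exit)
    then have "\<exists>T'. grown adj (insert d S) T'"
      unfolding graph_edges_def using grown.col[OF g] grown.row[OF g] by blast
    then show ?thesis using cd by (metis card_insert_disjoint finite)
  qed
  have "\<exists>S T. grown adj S T \<and> card S = k" if "1 \<le> k" "k \<le> CARD('i + 'j)" for k
    using that
  proof (induction k rule: dec_induct)
    case base
    show ?case using grown.root[of adj] by (metis One_nat_def card.empty card_insert_disjoint empty_iff finite)
  next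
    case (step k)
    then obtain S T where "grown adj S T" "card S = k" by auto
    moreover have "S \<noteq> UNIV" using step \<open>card S = k\<close> by auto
    ultimately show ?case using \<open>\<And>S T. \<lbrakk>grown adj S T; S \<noteq> UNIV\<rbrakk> \<Longrightarrow> _\<close> by blast
  qed
  from this[of "CARD('i + 'j)"] obtain S T where g: "grown adj S T" and "card S = CARD('i + 'j)"
    by (auto simp: Suc_le_eq card_gt_0_iff)
  then have S: "S = UNIV" by (metis card_subset_eq finite subset_UNIV)
  have "card T + 1 = CARD('i) + CARD('j)"
    using grown_card[OF g] S by (simp add: card_UNIV_sum)
  then have "card T = card {(i, j). adj i j}"
    using assms unfolding bip_tree_def by linarith
  moreover have "T \<subseteq> {(i, j). adj i j}" using grown_edge(3)[OF g] by auto
  ultimately show ?thesis using g S card_subset_eq[OF finite] by metis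
qed

text \<open>Peel off the last leaf: its edge must carry the whole sum \<open>t\<close> prescribed
  there, and subtracting \<open>t\<close> at the other end leaves a balanced problem on the smaller
  tree. Zero data outside \<open>S\<close> make this an induction over partial trees; at the root,
  balance forces the one remaining datum to vanish.\<close>

lemma grown_matrix_exists:
  fixes adj :: "'i::finite \<Rightarrow> 'j::finite \<Rightarrow> bool"
  assumes "grown adj S T"
    and "\<And>i. Inl i \<notin> S \<Longrightarrow> \<alpha> i = (0::real)" "\<And>j. Inr j \<notin> S \<Longrightarrow> \<beta> j = 0"
    and "(\<Sum>i\<in>UNIV. \<alpha> i) = (\<Sum>j\<in>UNIV. \<beta> j)"
  shows "\<exists>\<psi>. (\<forall>i. (\<Sum>j\<in>UNIV. \<psi> i j) = \<alpha> i) \<and> (\<forall>j. (\<Sum>i\<in>UNIV. \<psi> i j) = \<beta> j)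
       \<and> (\<forall>i j. (i, j) \<notin> T \<longrightarrow> \<psi> i j = 0)"
  using assms
proof (induction arbitrary: \<alpha> \<beta> rule: grown.induct)
  case (root v)
  have "\<alpha> = (\<lambda>_. 0) \<and> \<beta> = (\<lambda>_. 0)"
  proof (cases v)
    case (Inl a)
    then have b: "\<beta> = (\<lambda>_. 0)" using root by auto
    have "(\<Sum>i\<in>UNIV. \<alpha> i) = \<alpha> a" using root Inl by (subst sum.remove[of _ a]) auto
    then have "\<alpha> a = 0" using root b by simp
    moreover have "\<alpha> x = 0" if "x \<noteq> a" for x using root Inl that by auto
    ultimately show ?thesis using b by metis
  next
    case (Inr a)
    then have b: "\<alpha> = (\<lambda>_. 0)" using root by auto
    have "(\<Sum>i\<in>UNIV. \<beta> i) = \<beta> a" using root Inr by (subst sum.remove[of _ a]) auto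
    then have "\<beta> a = 0" using root b by simp
    moreover have "\<beta> x = 0" if "x \<noteq> a" for x using root Inr that by auto
    ultimately show ?thesis using b by metis
  qed
  then show ?case by (intro exI[of _ "\<lambda>_ _. 0"]) auto
next
  case (col S T i j)
  define t where "t = \<beta> j"
  let ?a = "\<lambda>k. \<alpha> k - (if k = i then t else 0)" and ?b = "\<lambda>k. \<beta> k - (if k = j then t else 0)"
  have "\<exists>\<psi>. (\<forall>i. (\<Sum>j\<in>UNIV. \<psi> i j) = ?a i) \<and> (\<forall>j. (\<Sum>i\<in>UNIV. \<psi> i j) = ?b j)
       \<and> (\<forall>i j. (i, j) \<notin> T \<longrightarrow> \<psi> i j = 0)"
    using col.hyps col.prems by (intro col.IH) (auto simp: sum_subtractf t_def)
  then obtain \<psi> where \<psi>: "\<And>i. (\<Sum>j\<in>UNIV. \<psi> i j) = ?a i" "\<And>j. (\<Sum>i\<in>UNIV. \<psi> i j) = ?b j"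
     "\<And>i j. (i, j) \<notin> T \<Longrightarrow> \<psi> i j = 0" by blast
  show ?case
    by (rule exI[of _ "\<lambda>a b. \<psi> a b + (if a = i then if b = j then t else 0 else 0)"])
      (auto simp: sum.distrib \<psi> if_distrib[of "\<lambda>f. sum f UNIV"] cong: if_cong)
next
  case (row S T j i)
  define t where "t = \<alpha> i"
  let ?a = "\<lambda>k. \<alpha> k - (if k = i then t else 0)" and ?b = "\<lambda>k. \<beta> k - (if k = j then t else 0)"
  have "\<exists>\<psi>. (\<forall>i. (\<Sum>j\<in>UNIV. \<psi> i j) = ?a i) \<and> (\<forall>j. (\<Sum>i\<in>UNIV. \<psi> i j) = ?b j)
       \<and> (\<forall>i j. (i, j) \<notin> T \<longrightarrow> \<psi> i j = 0)"
    using row.hyps row.prems by (intro row.IH) (auto simp: sum_subtractf t_def)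
  then obtain \<psi> where \<psi>: "\<And>i. (\<Sum>j\<in>UNIV. \<psi> i j) = ?a i" "\<And>j. (\<Sum>i\<in>UNIV. \<psi> i j) = ?b j"
     "\<And>i j. (i, j) \<notin> T \<Longrightarrow> \<psi> i j = 0" by blast
  show ?case
    by (rule exI[of _ "\<lambda>a b. \<psi> a b + (if a = i then if b = j then t else 0 else 0)"])
      (auto simp: sum.distrib \<psi> if_distrib[of "\<lambda>f. sum f UNIV"] cong: if_cong)
qed

section \<open>The weighted coercivity estimate along the growth\<close>

lemma sum_sum_delta:
  "(\<Sum>a\<in>UNIV. \<Sum>b\<in>UNIV. if a = i then if b = j then t else 0 else 0) = (t::real)"
  for i :: "'i::finite" and j :: "'j::finite"
proof -
  have "(\<Sum>b\<in>UNIV. if a = i then if b = j then t else 0 else 0) = (if a = i then t else 0)" for a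
    by simp
  then show ?thesis by simp
qed

lemma AM_GM_weighted:
  fixes a b c :: real
  assumes "c > 0"
  shows "\<bar>a * b\<bar> \<le> c * a\<^sup>2 + b\<^sup>2 / (4 * c)"
proof -
  have "0 \<le> (2 * c * \<bar>a\<bar> - \<bar>b\<bar>)\<^sup>2" by simp
  then have "4 * c * \<bar>a * b\<bar> \<le> 4 * c * (c * a\<^sup>2 + b\<^sup>2 / (4 * c))"
    using assms by (simp add: power2_diff abs_mult distrib_left power_mult_distrib) (simp add: power2_eq_square algebra_simps)
  then show ?thesis using assms by simp
qed

text \<open>The right-hand side is the drift form with both factors read off \<psi>. Quantifying
  over every \<psi> supported on \<open>T\<close>, with no prescribed sums, lets the induction
  delete the newest entry freely.\<close>

definition dissipative :: "('i::finite \<Rightarrow> 'j::finite \<Rightarrow> real) \<Rightarrow> ('i \<times> 'j) set \<Rightarrow> ('i \<Rightarrow> real) \<Rightarrow> real \<Rightarrow> real \<Rightarrow> bool"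
  where "dissipative \<mu> T q \<kappa> C \<longleftrightarrow> (\<forall>i. q i > 0) \<and> \<kappa> > 0 \<and> C \<ge> 0 \<and>
    (\<forall>\<psi>. (\<forall>i j. (i, j) \<notin> T \<longrightarrow> \<psi> i j = 0) \<longrightarrow>
      \<kappa> * (\<Sum>i\<in>UNIV. \<Sum>j\<in>UNIV. (\<psi> i j)\<^sup>2) - C * (\<Sum>j\<in>UNIV. (\<Sum>i\<in>UNIV. \<psi> i j)\<^sup>2)
        \<le> (\<Sum>i\<in>UNIV. q i * (\<Sum>j\<in>UNIV. \<psi> i j) * (\<Sum>j\<in>UNIV. \<mu> i j * \<psi> i j)))"

lemma dissipativeD:
  assumes "dissipative \<mu> T q \<kappa> C"
  shows "q i > 0" "\<kappa> > 0" "C \<ge> 0"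
    and "(\<And>i j. (i, j) \<notin> T \<Longrightarrow> \<psi> i j = 0) \<Longrightarrow>
      \<kappa> * (\<Sum>i\<in>UNIV. \<Sum>j\<in>UNIV. (\<psi> i j)\<^sup>2) - C * (\<Sum>j\<in>UNIV. (\<Sum>i\<in>UNIV. \<psi> i j)\<^sup>2)
        \<le> (\<Sum>i\<in>UNIV. q i * (\<Sum>j\<in>UNIV. \<psi> i j) * (\<Sum>j\<in>UNIV. \<mu> i j * \<psi> i j))"
  using assms unfolding dissipative_def by simp_all

text \<open>A new edge alters only the product belonging to its own row, so the old estimate can be
  reused on the matrix with that entry deleted. A column leaf costs half of \<kappa>, a row leaf
  doubles \<open>C\<close>.\<close>

lemma grown_dissipative:
  fixes adj :: "'i::finite \<Rightarrow> 'j::finite \<Rightarrow> bool"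
  assumes "grown adj S T" and "\<And>i j. adj i j \<Longrightarrow> \<mu> i j > (0::real)"
  shows "\<exists>q \<kappa> C. dissipative \<mu> T q \<kappa> C"
  using assms(1)
proof (induction rule: grown.induct)
  case (root v)
  show ?case unfolding dissipative_def by (intro exI[of _ "\<lambda>_. 1"] exI[of _ 1]) auto
next
  (* The new edge value t is the whole new column sum, so the enlarged penalty absorbs all terms in t. *)
  case (col S T i j)
  then obtain q \<kappa> C where "dissipative \<mu> T q \<kappa> C" by blast
  note q = dissipativeD(1-3)[OF this] and IH = dissipativeD(4)[OF this]
  have mu: "\<mu> i j > 0" using assms(2) col by blast
  \<comment> \<open>\<open>L\<close> bounds the Cauchy-Schwarz constant of the cross term
    \<open>D\<close> below, and \<open>+ 1\<close> keeps it positive. \<open>c\<close> is tuned so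
    that \<open>c * L = \<kappa> / 2\<close>, and \<open>K\<close> is what AM-GM then charges to
    \<open>t\<^sup>2\<close>.\<close>
  define L where "L = (\<Sum>b\<in>UNIV. (\<mu> i b + \<mu> i j)\<^sup>2) + 1"
  have L: "L > 0" unfolding L_def by (intro add_nonneg_pos sum_nonneg) auto
  define c where "c = \<kappa> / (2 * L)"
  have c: "c > 0" using q L by (simp add: c_def)
  define K where "K = (q i)\<^sup>2 / (4 * c)"
  have K: "K \<ge> 0" using c by (simp add: K_def)
  show ?case unfolding dissipative_def
  \<comment> \<open>The penalty grows by \<open>K\<close> for the cross term and by
    \<open>\<kappa> / 2\<close> for the share of the new entry in |psi'|^2.\<close>
  proof (rule exI[of _ q], rule exI[of _ "\<kappa> / 2"], rule exI[of _ "C + K + \<kappa> / 2"], intro conjI allI impI)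
    fix \<psi>' :: "'i \<Rightarrow> 'j \<Rightarrow> real"
    assume sup: "\<forall>a b. (a, b) \<notin> insert (i, j) T \<longrightarrow> \<psi>' a b = 0"
    define t where "t = \<psi>' i j"
    define \<psi> where "\<psi> a b = (if a = i then if b = j then 0 else \<psi>' a b else \<psi>' a b)" for a b
    have \<psi>': "\<psi>' a b = \<psi> a b + (if a = i then if b = j then t else 0 else 0)" for a b
      by (simp add: \<psi>_def t_def)
    have ij: "\<psi> i j = 0" by (simp add: \<psi>_def)
    have supT: "\<psi> a b = 0" if "(a, b) \<notin> T" for a b using sup that by (auto simp: \<psi>_def)
    have colj: "\<psi> a j = 0" for a using supT grown_edge(2)[OF col.hyps(1)] col.hyps by blast
    define n2 where "n2 = (\<Sum>a\<in>UNIV. \<Sum>b\<in>UNIV. (\<psi> a b)\<^sup>2)"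
    define B where "B = (\<Sum>b\<in>UNIV. (\<Sum>a\<in>UNIV. \<psi> a b)\<^sup>2)"
    have e1: "(\<Sum>a\<in>UNIV. \<Sum>b\<in>UNIV. (\<psi>' a b)\<^sup>2) = n2 + t\<^sup>2"
    proof -
      have "(\<psi>' a b)\<^sup>2 = (\<psi> a b)\<^sup>2 + (if a = i then if b = j then t\<^sup>2 else 0 else 0)" for a b
        using ij by (auto simp: \<psi>')
      then show ?thesis
        by (simp add: sum.distrib n2_def sum_sum_delta)
    qed
    have "(\<Sum>a\<in>UNIV. \<psi>' a b)\<^sup>2 = (\<Sum>a\<in>UNIV. \<psi> a b)\<^sup>2 + (if b = j then t\<^sup>2 else 0)" for b
      using colj by (auto simp: \<psi>' sum.distrib)
    then have e2: "(\<Sum>b\<in>UNIV. (\<Sum>a\<in>UNIV. \<psi>' a b)\<^sup>2) = B + t\<^sup>2"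
      by (simp add: sum.distrib B_def)
    \<comment> \<open>With R and W the plain and the weighted sum of the old row \<open>i\<close>,
      the mixed terms of (R + t) (W + \<mu> t) are t (W + \<mu> R), which is
      \<open>t * D\<close>.\<close>
    define D where "D = (\<Sum>b\<in>UNIV. (\<mu> i b + \<mu> i j) * \<psi> i b)"
    have "q a * (\<Sum>b\<in>UNIV. \<psi>' a b) * (\<Sum>b\<in>UNIV. \<mu> a b * \<psi>' a b) =
        q a * (\<Sum>b\<in>UNIV. \<psi> a b) * (\<Sum>b\<in>UNIV. \<mu> a b * \<psi> a b)
        + (if a = i then t * (q i * D) + q i * \<mu> i j * t\<^sup>2 else 0)" for a
      by (auto simp: \<psi>' sum.distrib D_def distrib_left distrib_right sum_distrib_left power2_eq_square
          if_distrib[of "\<lambda>x. _ * x"] cong: if_cong)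
        (simp add: algebra_simps sum_distrib_left sum_distrib_right)
    then have e3: "(\<Sum>a\<in>UNIV. q a * (\<Sum>b\<in>UNIV. \<psi>' a b) * (\<Sum>b\<in>UNIV. \<mu> a b * \<psi>' a b)) =
        (\<Sum>a\<in>UNIV. q a * (\<Sum>b\<in>UNIV. \<psi> a b) * (\<Sum>b\<in>UNIV. \<mu> a b * \<psi> a b))
        + (t * (q i * D) + q i * \<mu> i j * t\<^sup>2)"
      by (simp add: sum.distrib)
    have "D\<^sup>2 \<le> (\<Sum>b\<in>UNIV. (\<mu> i b + \<mu> i j)\<^sup>2) * (\<Sum>b\<in>UNIV. (\<psi> i b)\<^sup>2)"
      unfolding D_def by (rule Cauchy_Schwarz_ineq_sum)
    also have "\<dots> \<le> L * n2"
    proof (intro mult_mono)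
      show "(\<Sum>b\<in>UNIV. (\<psi> i b)\<^sup>2) \<le> n2" unfolding n2_def
        by (rule member_le_sum[of i UNIV "\<lambda>a. \<Sum>b\<in>UNIV. (\<psi> a b)\<^sup>2"]) (auto intro: sum_nonneg)
    qed (use L in \<open>auto simp: L_def intro: sum_nonneg\<close>)
    finally have "c * D\<^sup>2 \<le> c * (L * n2)" using c by simp
    also have "c * (L * n2) = \<kappa> / 2 * n2" using L by (simp add: c_def)
    finally have D: "c * D\<^sup>2 \<le> \<kappa> / 2 * n2" .
    have "\<bar>D * (q i * t)\<bar> \<le> c * D\<^sup>2 + (q i * t)\<^sup>2 / (4 * c)" by (rule AM_GM_weighted[OF c])
    also have "(q i * t)\<^sup>2 / (4 * c) = K * t\<^sup>2" by (simp add: K_def power_mult_distrib)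
    finally have "t * (q i * D) \<ge> - (\<kappa> / 2 * n2) - K * t\<^sup>2"
      using D by (simp add: mult.commute mult.left_commute)
    moreover have "q i * \<mu> i j * t\<^sup>2 \<ge> 0" using q mu by (simp add: less_imp_le)
    moreover have "\<kappa> * n2 - C * B \<le> (\<Sum>a\<in>UNIV. q a * (\<Sum>b\<in>UNIV. \<psi> a b) * (\<Sum>b\<in>UNIV. \<mu> a b * \<psi> a b))"
      unfolding n2_def B_def using supT by (rule IH)
    moreover have "B \<ge> 0" unfolding B_def by (simp add: sum_nonneg)
    then have "K * B \<ge> 0" "\<kappa> * B \<ge> 0" "C * t\<^sup>2 \<ge> 0" using K q by (simp_all add: less_imp_le)
    ultimately show "\<kappa> / 2 * (\<Sum>a\<in>UNIV. \<Sum>b\<in>UNIV. (\<psi>' a b)\<^sup>2)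
        - (C + K + \<kappa> / 2) * (\<Sum>b\<in>UNIV. (\<Sum>a\<in>UNIV. \<psi>' a b)\<^sup>2)
        \<le> (\<Sum>a\<in>UNIV. q a * (\<Sum>b\<in>UNIV. \<psi>' a b) * (\<Sum>b\<in>UNIV. \<mu> a b * \<psi>' a b))"
      unfolding e1 e2 e3 by (simp add: algebra_simps)
  qed (use q K in auto)
next
  (* The new edge changes an old column sum; a large weight Q on the new row pays for that. *)
  case (row S T j i)
  then obtain q \<kappa> C where "dissipative \<mu> T q \<kappa> C" by blast
  note q = dissipativeD(1-3)[OF this] and IH = dissipativeD(4)[OF this]
  have mu: "\<mu> i j > 0" using assms(2) row by blast
  \<comment> \<open>\<open>Q * \<mu> i j\<close> splits into \<kappa> for the square of the new
    entry and \<open>2 * C\<close> for the shift of column \<open>j\<close>, bounded through x^2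
    \<le> 2 (x + t)^2 + 2 t^2.\<close>
  define Q where "Q = (2 * C + \<kappa>) / \<mu> i j"
  have Q: "Q > 0" using q mu by (simp add: Q_def add_nonneg_pos)
  have Qmu: "Q * \<mu> i j = 2 * C + \<kappa>" using mu by (simp add: Q_def)
  show ?case unfolding dissipative_def
  proof (rule exI[of _ "q(i := Q)"], rule exI[of _ "\<kappa>"], rule exI[of _ "2 * C"], intro conjI allI impI)
    fix \<psi>' :: "'i \<Rightarrow> 'j \<Rightarrow> real"
    assume sup: "\<forall>a b. (a, b) \<notin> insert (i, j) T \<longrightarrow> \<psi>' a b = 0"
    define t where "t = \<psi>' i j"
    define \<psi> where "\<psi> a b = (if a = i then if b = j then 0 else \<psi>' a b else \<psi>' a b)" for a b
    have \<psi>': "\<psi>' a b = \<psi> a b + (if a = i then if b = j then t else 0 else 0)" for a b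
      by (simp add: \<psi>_def t_def)
    have supT: "\<psi> a b = 0" if "(a, b) \<notin> T" for a b using sup that by (auto simp: \<psi>_def)
    \<comment> \<open>The new row was empty before, so the form gains a pure square in
      \<open>t\<close> with no cross term.\<close>
    have rowi: "\<psi> i b = 0" for b using supT grown_edge(1)[OF row.hyps(1)] row.hyps by blast
    define n2 where "n2 = (\<Sum>a\<in>UNIV. \<Sum>b\<in>UNIV. (\<psi> a b)\<^sup>2)"
    define B where "B = (\<Sum>b\<in>UNIV. (\<Sum>a\<in>UNIV. \<psi> a b)\<^sup>2)"
    define B' where "B' = (\<Sum>b\<in>UNIV. (\<Sum>a\<in>UNIV. \<psi>' a b)\<^sup>2)"
    have e1: "(\<Sum>a\<in>UNIV. \<Sum>b\<in>UNIV. (\<psi>' a b)\<^sup>2) = n2 + t\<^sup>2"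
    proof -
      have "(\<psi>' a b)\<^sup>2 = (\<psi> a b)\<^sup>2 + (if a = i then if b = j then t\<^sup>2 else 0 else 0)" for a b
        using rowi by (auto simp: \<psi>')
      then show ?thesis
        by (simp add: sum.distrib n2_def sum_sum_delta)
    qed
    have "(\<Sum>a\<in>UNIV. \<psi> a b)\<^sup>2 \<le> 2 * (\<Sum>a\<in>UNIV. \<psi>' a b)\<^sup>2 + (if b = j then 2 * t\<^sup>2 else 0)" for b
    proof -
      have "x\<^sup>2 \<le> 2 * (x + t)\<^sup>2 + 2 * t\<^sup>2" for x
        using zero_le_power2[of "x + 2 * t"] by (simp add: power2_eq_square algebra_simps)
      then show ?thesis by (auto simp: \<psi>' sum.distrib)
    qed
    then have "B \<le> (\<Sum>b\<in>UNIV. 2 * (\<Sum>a\<in>UNIV. \<psi>' a b)\<^sup>2 + (if b = j then 2 * t\<^sup>2 else 0))"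
      unfolding B_def by (rule sum_mono)
    then have e2: "B \<le> 2 * B' + 2 * t\<^sup>2" by (simp add: sum.distrib B'_def sum_distrib_left)
    have "(q(i := Q)) a * (\<Sum>b\<in>UNIV. \<psi>' a b) * (\<Sum>b\<in>UNIV. \<mu> a b * \<psi>' a b) =
        q a * (\<Sum>b\<in>UNIV. \<psi> a b) * (\<Sum>b\<in>UNIV. \<mu> a b * \<psi> a b)
        + (if a = i then Q * \<mu> i j * t\<^sup>2 else 0)" for a
      using rowi by (auto simp: \<psi>' power2_eq_square if_distrib[of "\<lambda>x. _ * x"] cong: if_cong)
    then have e3: "(\<Sum>a\<in>UNIV. (q(i := Q)) a * (\<Sum>b\<in>UNIV. \<psi>' a b) * (\<Sum>b\<in>UNIV. \<mu> a b * \<psi>' a b)) =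
        (\<Sum>a\<in>UNIV. q a * (\<Sum>b\<in>UNIV. \<psi> a b) * (\<Sum>b\<in>UNIV. \<mu> a b * \<psi> a b)) + (2 * C + \<kappa>) * t\<^sup>2"
      by (simp add: sum.distrib Qmu)
    have "\<kappa> * n2 - C * B \<le> (\<Sum>a\<in>UNIV. q a * (\<Sum>b\<in>UNIV. \<psi> a b) * (\<Sum>b\<in>UNIV. \<mu> a b * \<psi> a b))"
      unfolding n2_def B_def using supT by (rule IH)
    moreover have "C * B \<le> C * (2 * B' + 2 * t\<^sup>2)" using e2 q by (simp add: mult_left_mono)
    ultimately show "\<kappa> * (\<Sum>a\<in>UNIV. \<Sum>b\<in>UNIV. (\<psi>' a b)\<^sup>2)
        - 2 * C * (\<Sum>b\<in>UNIV. (\<Sum>a\<in>UNIV. \<psi>' a b)\<^sup>2)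
        \<le> (\<Sum>a\<in>UNIV. (q(i := Q)) a * (\<Sum>b\<in>UNIV. \<psi>' a b) * (\<Sum>b\<in>UNIV. \<mu> a b * \<psi>' a b))"
      unfolding e1 e3 B'_def[symmetric] by (simp add: algebra_simps)
  qed (use q Q in auto)
qed

subsection \<open>Dissipativity of the drift\<close>

text \<open>\<open>Gmat\<close> is a definite description, so its properties need existence and
  uniqueness. The difference of two candidates has zero row and column sums; the form and the
  penalty vanish there, leaving \<kappa> |\<theta>|^2 \<le> 0. Any positive rates would do, and 1 is
  taken.\<close>

lemma Gmat_props:
  fixes adj :: "'i::finite \<Rightarrow> 'j::finite \<Rightarrow> bool"
  assumes "bip_tree adj" and "(\<Sum>i\<in>UNIV. \<alpha> i) = (\<Sum>j\<in>UNIV. \<beta> j)"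
  shows "(\<Sum>j\<in>UNIV. Gmat adj \<alpha> \<beta> i j) = \<alpha> i" "(\<Sum>i\<in>UNIV. Gmat adj \<alpha> \<beta> i j) = \<beta> j"
    "\<not> adj i j \<Longrightarrow> Gmat adj \<alpha> \<beta> i j = 0"
proof -
  let ?P = "\<lambda>\<psi>. (\<forall>i. (\<Sum>j\<in>UNIV. \<psi> i j) = \<alpha> i) \<and> (\<forall>j. (\<Sum>i\<in>UNIV. \<psi> i j) = \<beta> j)
       \<and> (\<forall>i j. \<not> adj i j \<longrightarrow> \<psi> i j = 0)"
  have g: "grown adj UNIV {(i, j). adj i j}" by (rule bip_tree_grown[OF assms(1)])
  obtain \<psi> where \<psi>: "?P \<psi>"
    using grown_matrix_exists[OF g _ _ assms(2)] by auto
  obtain q \<kappa> C where d: "dissipative (\<lambda>_ _. 1) {(i, j). adj i j} q \<kappa> C"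
    using grown_dissipative[OF g, of "\<lambda>_ _. 1"] by auto
  have uniq: "\<phi> = \<psi>" if \<phi>: "?P \<phi>" for \<phi>
  proof -
    define \<theta> where "\<theta> i j = \<phi> i j - \<psi> i j" for i j
    have r: "(\<Sum>j\<in>UNIV. \<theta> i j) = 0" "(\<Sum>i\<in>UNIV. \<theta> i j) = 0" for i j
      using \<psi> \<phi> by (simp_all add: \<theta>_def sum_subtractf)
    have "\<kappa> * (\<Sum>i\<in>UNIV. \<Sum>j\<in>UNIV. (\<theta> i j)\<^sup>2) - C * (\<Sum>j\<in>UNIV. (\<Sum>i\<in>UNIV. \<theta> i j)\<^sup>2)
        \<le> (\<Sum>i\<in>UNIV. q i * (\<Sum>j\<in>UNIV. \<theta> i j) * (\<Sum>j\<in>UNIV. 1 * \<theta> i j))"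
      using \<psi> \<phi> by (intro dissipativeD(4)[OF d]) (auto simp: \<theta>_def)
    then have "\<kappa> * (\<Sum>i\<in>UNIV. \<Sum>j\<in>UNIV. (\<theta> i j)\<^sup>2) \<le> 0" by (simp add: r)
    then have "(\<Sum>i\<in>UNIV. \<Sum>j\<in>UNIV. (\<theta> i j)\<^sup>2) \<le> 0"
      using dissipativeD(2)[OF d] by (simp add: mult_le_0_iff)
    moreover have "(\<theta> i j)\<^sup>2 \<le> (\<Sum>i\<in>UNIV. \<Sum>j\<in>UNIV. (\<theta> i j)\<^sup>2)" for i j
    proof -
      have "(\<theta> i j)\<^sup>2 \<le> (\<Sum>j\<in>UNIV. (\<theta> i j)\<^sup>2)"
        by (rule member_le_sum[of j UNIV "\<lambda>j. (\<theta> i j)\<^sup>2"]) auto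
      also have "\<dots> \<le> (\<Sum>i\<in>UNIV. \<Sum>j\<in>UNIV. (\<theta> i j)\<^sup>2)"
        by (rule member_le_sum[of i UNIV "\<lambda>i. \<Sum>j\<in>UNIV. (\<theta> i j)\<^sup>2"]) (auto intro: sum_nonneg)
      finally show ?thesis .
    qed
    ultimately have "(\<theta> i j)\<^sup>2 \<le> 0" for i j by (meson order_trans)
    then show ?thesis by (simp add: \<theta>_def fun_eq_iff)
  qed
  have "?P (Gmat adj \<alpha> \<beta>)"
    unfolding Gmat_def by (rule theI[of ?P, OF \<psi> uniq])
  then show "(\<Sum>j\<in>UNIV. Gmat adj \<alpha> \<beta> i j) = \<alpha> i" "(\<Sum>i\<in>UNIV. Gmat adj \<alpha> \<beta> i j) = \<beta> j"
    "\<not> adj i j \<Longrightarrow> Gmat adj \<alpha> \<beta> i j = 0" by auto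
qed

section \<open>Elementary bounds for the norm, the total mass and the simplex\<close>

lemma norm_sq_sum: "(norm (x :: real ^ 'n))\<^sup>2 = (\<Sum>i\<in>UNIV. (x $ i)\<^sup>2)"
  unfolding power2_norm_eq_inner inner_vec_def by (simp add: power2_eq_square)

lemma abs_esum_le: "\<bar>esum (x :: real ^ 'n)\<bar> \<le> real CARD('n) * norm x"
proof -
  have "\<bar>esum x\<bar> \<le> (\<Sum>i\<in>UNIV. \<bar>x $ i\<bar>)" unfolding esum_def by (rule sum_abs)
  also have "\<dots> \<le> (\<Sum>i\<in>(UNIV::'n set). norm x)" by (intro sum_mono component_le_norm_cart)
  finally show ?thesis by simp
qed

lemma pospart_negpart_bounds:
  "0 \<le> pospart s" "0 \<le> negpart s" "pospart s \<le> \<bar>s\<bar>" "negpart s \<le> \<bar>s\<bar>" "pospart s - negpart s = s"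
  by (auto simp: pospart_def negpart_def)

lemma simplex_bounds:
  fixes v :: "'n::finite \<Rightarrow> real"
  assumes "\<And>i. v i \<ge> 0" "(\<Sum>i\<in>UNIV. v i) = 1"
  shows "v i \<le> 1" "(v i)\<^sup>2 \<le> 1" "(\<Sum>i\<in>UNIV. (v i)\<^sup>2) \<le> 1"
proof -
  have le: "v i \<le> 1" for i
    using member_le_sum[of i UNIV v] assms by simp
  show "v i \<le> 1" "(v i)\<^sup>2 \<le> 1" using le assms by (simp_all add: power_le_one)
  have "(\<Sum>i\<in>UNIV. (v i)\<^sup>2) \<le> (\<Sum>i\<in>UNIV. v i)"
    using le assms by (intro sum_mono) (simp add: power2_eq_square mult_left_le)
  then show "(\<Sum>i\<in>UNIV. (v i)\<^sup>2) \<le> 1" using assms by simp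
qed

text \<open>The tree estimate tests with the row sums \<alpha> = x - p u^c, the Lyapunov function
  with x. The mismatch is of size |e.x| and is absorbed by AM-GM into one half of \<kappa>
  |\<psi>|^2; the other half becomes the term in |x|^2. All remaining errors are multiples of |x|
  |e.x| or |x|.\<close>

lemma drift_dissipative:
  fixes adj :: "'i::finite \<Rightarrow> 'j::finite \<Rightarrow> bool"
  assumes tree: "bip_tree adj" and mu: "\<And>i j. adj i j \<Longrightarrow> \<mu> i j > 0"
    and gam: "\<And>i. \<gamma> i \<ge> 0"
  obtains q a K where "\<And>i. q i > 0" "a > 0" "K \<ge> 0"
    "\<And>x u. u \<in> Uset \<Longrightarrow> (\<Sum>i\<in>UNIV. q i * x $ i * drift adj \<mu> \<gamma> ell x u $ i)
       \<le> - a * (norm x)\<^sup>2 + K * norm x * \<bar>esum x\<bar> + K * norm x"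
proof -
  obtain q \<kappa> C where d: "dissipative \<mu> {(i, j). adj i j} q \<kappa> C"
    using grown_dissipative[OF bip_tree_grown[OF tree], of \<mu>] mu by blast
  note q = dissipativeD(1-3)[OF d]
  define L where "L = (\<Sum>i\<in>UNIV. \<Sum>j\<in>UNIV. (\<mu> i j)\<^sup>2) + 1"
  have L: "L > 0" unfolding L_def by (intro add_nonneg_pos sum_nonneg) auto
  \<comment> \<open>\<open>c * L = \<kappa> / 2\<close> is the half spent on the mismatch.\<close>
  define c where "c = \<kappa> / (2 * L)"
  have c: "c > 0" using q L by (simp add: c_def)
  define K1 where "K1 = (\<Sum>i\<in>UNIV. (q i)\<^sup>2 / (4 * c))"
  define K2 where "K2 = (\<Sum>i\<in>UNIV. q i * \<bar>ell i\<bar>)"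
  define K3 where "K3 = (\<Sum>i\<in>UNIV. q i * \<gamma> i)"
  \<comment> \<open>The unspent \<open>\<kappa> / 2\<close>, divided by the Cauchy-Schwarz constant
    J of a row sum.\<close>
  define a where "a = \<kappa> / (2 * real CARD('j))"
  have a: "a > 0" using q by (simp add: a_def)
  have K0: "K1 \<ge> 0" "K2 \<ge> 0" "K3 \<ge> 0"
    using less_imp_le[OF q(1)] c gam unfolding K1_def K2_def K3_def
    by (auto intro!: sum_nonneg mult_nonneg_nonneg divide_nonneg_pos)
  \<comment> \<open>\<open>2 * a\<close> comes from replacing |\<alpha>|^2 by |x|^2,
    \<open>K2\<close> from \<open>ell\<close>, \<open>K3\<close> from \<gamma>, and the first
    summand from the multiples of (e.x)^2. The sum bounds both the coefficient of |x| |e.x| and that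
    of |x|.\<close>
  define K where "K = (C + K1) * real CARD('i) + K2 + K3 + 2 * a"
  have K: "K \<ge> 0" unfolding K_def using K0 q a by (intro add_nonneg_nonneg mult_nonneg_nonneg) auto
  have "(\<Sum>i\<in>UNIV. q i * x $ i * drift adj \<mu> \<gamma> ell x u $ i)
       \<le> - a * (norm x)\<^sup>2 + K * norm x * \<bar>esum x\<bar> + K * norm x" if u: "u \<in> Uset" for x u
  proof -
    define s v w where "s = esum x" and "v = fst u" and "w = snd u"
    have v: "\<And>i. v i \<ge> 0" "(\<Sum>i\<in>UNIV. v i) = 1" and w: "\<And>j. w j \<ge> 0" "(\<Sum>j\<in>UNIV. w j) = 1"
      using u by (auto simp: Uset_def v_def w_def)
    define p n where "p = pospart s" and "n = negpart s"
    have pn: "0 \<le> p" "0 \<le> n" "p \<le> \<bar>s\<bar>" "n \<le> \<bar>s\<bar>" "p - n = s"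
      unfolding p_def n_def by (rule pospart_negpart_bounds)+
    have p2: "p\<^sup>2 \<le> s\<^sup>2" "n\<^sup>2 \<le> s\<^sup>2" using pn by (simp_all add: abs_le_square_iff[symmetric])
    define \<psi> where "\<psi> = Ghat adj u x"
    \<comment> \<open>The two margins balance because \<open>p - n = s\<close>; without this
      \<open>Gmat_props\<close> says nothing.\<close>
    have sm: "(\<Sum>i\<in>UNIV. x $ i - p * v i) = (\<Sum>j\<in>UNIV. - n * w j)"
      using v w pn by (simp add: sum_subtractf sum_distrib_left[symmetric] s_def esum_def sum_negf)
    note G = Gmat_props[OF tree sm]
    have \<psi>G: "\<psi> = Gmat adj (\<lambda>i. x $ i - p * v i) (\<lambda>j. - n * w j)"
      by (simp add: \<psi>_def Ghat_def p_def n_def s_def v_def w_def)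
    define \<alpha> where "\<alpha> i = x $ i - p * v i" for i
    have row: "(\<Sum>j\<in>UNIV. \<psi> i j) = \<alpha> i" for i unfolding \<psi>G \<alpha>_def by (rule G)
    have col: "(\<Sum>i\<in>UNIV. \<psi> i j) = - n * w j" for j unfolding \<psi>G by (rule G)
    have sup: "\<psi> i j = 0" if "\<not> adj i j" for i j unfolding \<psi>G using that by (rule G)
    define N where "N = (\<Sum>i\<in>UNIV. \<Sum>j\<in>UNIV. (\<psi> i j)\<^sup>2)"
    define W where "W i = (\<Sum>j\<in>UNIV. \<mu> i j * \<psi> i j)" for i
    have b: "drift adj \<mu> \<gamma> ell x u $ i = - W i - \<gamma> i * p * v i + ell i" for i
    proof -
      have "(\<Sum>j\<in>{j. adj i j}. \<mu> i j * \<psi> i j) = W i"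
        unfolding W_def using sup by (intro sum.mono_neutral_left) auto
      then show ?thesis by (simp add: drift_def \<psi>_def p_def s_def v_def)
    qed
    have "\<kappa> * N - C * (\<Sum>j\<in>UNIV. (- n * w j)\<^sup>2) \<le> (\<Sum>i\<in>UNIV. q i * \<alpha> i * W i)"
      using dissipativeD(4)[OF d, of \<psi>] sup unfolding row col N_def W_def by auto
    moreover have "(\<Sum>j\<in>UNIV. (- n * w j)\<^sup>2) \<le> s\<^sup>2"
    proof -
      have "(\<Sum>j\<in>UNIV. (- n * w j)\<^sup>2) = n\<^sup>2 * (\<Sum>j\<in>UNIV. (w j)\<^sup>2)"
        by (simp add: power_mult_distrib sum_distrib_left)
      also have "\<dots> \<le> s\<^sup>2 * 1" using simplex_bounds(3)[OF w] p2 by (intro mult_mono) (auto intro: sum_nonneg)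
      finally show ?thesis by simp
    qed
    then have "C * (\<Sum>j\<in>UNIV. (- n * w j)\<^sup>2) \<le> C * s\<^sup>2" using q by (simp add: mult_left_mono)
    ultimately have A: "- (\<Sum>i\<in>UNIV. q i * \<alpha> i * W i) \<le> - \<kappa> * N + C * s\<^sup>2" by simp
    have "(\<Sum>i\<in>UNIV. - (p * v i * q i) * W i) \<le> (\<Sum>i\<in>UNIV. c * (W i)\<^sup>2 + s\<^sup>2 * ((q i)\<^sup>2 / (4 * c)))"
    proof (rule sum_mono)
      fix i
      have "- (p * v i * q i) * W i \<le> \<bar>W i * (p * v i * q i)\<bar>"
        using abs_ge_minus_self[of "W i * (p * v i * q i)"] by (simp add: mult.commute)
      also have "\<dots> \<le> c * (W i)\<^sup>2 + (p * v i * q i)\<^sup>2 / (4 * c)" by (rule AM_GM_weighted[OF c])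
      also have "(p * v i * q i)\<^sup>2 \<le> s\<^sup>2 * 1 * (q i)\<^sup>2"
        unfolding power_mult_distrib using p2 simplex_bounds(2)[OF v] by (intro mult_mono) auto
      finally show "- (p * v i * q i) * W i \<le> c * (W i)\<^sup>2 + s\<^sup>2 * ((q i)\<^sup>2 / (4 * c))"
        using c by (simp add: divide_right_mono)
    qed
    also have "\<dots> = c * (\<Sum>i\<in>UNIV. (W i)\<^sup>2) + K1 * s\<^sup>2"
      by (simp add: sum.distrib K1_def sum_distrib_left sum_distrib_right mult.commute)
    also have "(\<Sum>i\<in>UNIV. (W i)\<^sup>2) \<le> (\<Sum>i\<in>UNIV. L * (\<Sum>j\<in>UNIV. (\<psi> i j)\<^sup>2))"
    proof (rule sum_mono)
      fix i
      have "(\<Sum>j\<in>UNIV. (\<mu> i j)\<^sup>2) \<le> (\<Sum>i\<in>UNIV. \<Sum>j\<in>UNIV. (\<mu> i j)\<^sup>2)"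
        by (rule member_le_sum[of i UNIV "\<lambda>i. \<Sum>j\<in>UNIV. (\<mu> i j)\<^sup>2"]) (auto intro: sum_nonneg)
      then have "(\<Sum>j\<in>UNIV. (\<mu> i j)\<^sup>2) * (\<Sum>j\<in>UNIV. (\<psi> i j)\<^sup>2) \<le> L * (\<Sum>j\<in>UNIV. (\<psi> i j)\<^sup>2)"
        by (intro mult_right_mono) (auto simp: L_def intro: sum_nonneg)
      then show "(W i)\<^sup>2 \<le> L * (\<Sum>j\<in>UNIV. (\<psi> i j)\<^sup>2)"
        unfolding W_def using Cauchy_Schwarz_ineq_sum order_trans by blast
    qed
    also have "c * (\<Sum>i\<in>UNIV. L * (\<Sum>j\<in>UNIV. (\<psi> i j)\<^sup>2)) = \<kappa> / 2 * N"
      using L by (simp add: c_def N_def sum_distrib_left[symmetric])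
    finally have B: "(\<Sum>i\<in>UNIV. - (p * v i * q i) * W i) \<le> \<kappa> / 2 * N + K1 * s\<^sup>2" using c by simp
    have "(\<Sum>i\<in>UNIV. q i * x $ i * (ell i - \<gamma> i * p * v i))
        \<le> (\<Sum>i\<in>UNIV. norm x * (q i * \<bar>ell i\<bar>) + norm x * \<bar>s\<bar> * (q i * \<gamma> i))"
    proof (rule sum_mono)
      fix i
      have "q i * x $ i * (ell i - \<gamma> i * p * v i) \<le> \<bar>q i * x $ i * (ell i - \<gamma> i * p * v i)\<bar>" by simp
      also have "\<dots> = q i * \<bar>x $ i\<bar> * \<bar>ell i - \<gamma> i * p * v i\<bar>"
        using q(1)[of i] by (simp add: abs_mult)
      also have "\<dots> \<le> q i * norm x * (\<bar>ell i\<bar> + \<gamma> i * \<bar>s\<bar>)"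
      proof (intro mult_mono mult_left_mono component_le_norm_cart)
        have "\<gamma> i * p * v i \<le> \<gamma> i * \<bar>s\<bar> * 1"
          using gam pn v simplex_bounds(1)[OF v] by (intro mult_mono) auto
        moreover have "\<gamma> i * p * v i \<ge> 0" using gam pn v by simp
        ultimately show "\<bar>ell i - \<gamma> i * p * v i\<bar> \<le> \<bar>ell i\<bar> + \<gamma> i * \<bar>s\<bar>" by linarith
      qed (use q(1)[of i] in auto)
      finally show "q i * x $ i * (ell i - \<gamma> i * p * v i)
          \<le> norm x * (q i * \<bar>ell i\<bar>) + norm x * \<bar>s\<bar> * (q i * \<gamma> i)"
        by (simp add: algebra_simps)
    qed
    also have "\<dots> = K2 * norm x + K3 * norm x * \<bar>s\<bar>"
      by (simp add: sum.distrib K2_def K3_def sum_distrib_left[symmetric])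
    finally have D: "(\<Sum>i\<in>UNIV. q i * x $ i * (ell i - \<gamma> i * p * v i)) \<le> K2 * norm x + K3 * norm x * \<bar>s\<bar>" .
    \<comment> \<open>Expand the square and drop \<open>(p * v i)\<^sup>2\<close>; the cross term is
      a \<open>v\<close>-average of the coordinates, hence at most |x|.\<close>
    have "(norm x)\<^sup>2 - 2 * norm x * \<bar>s\<bar> \<le> (\<Sum>i\<in>UNIV. (\<alpha> i)\<^sup>2)"
    proof -
      have "(\<Sum>i\<in>UNIV. v i * (x $ i)) \<le> (\<Sum>i\<in>UNIV. v i * norm x)"
        using v component_le_norm_cart[of x] by (intro sum_mono mult_left_mono) (auto simp: abs_le_iff)
      also have "\<dots> = norm x" using v by (simp add: sum_distrib_right[symmetric])
      finally have "p * (\<Sum>i\<in>UNIV. v i * (x $ i)) \<le> \<bar>s\<bar> * norm x"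
        using pn by (meson abs_ge_zero mult_left_mono mult_right_mono norm_ge_zero order_trans)
      moreover have "(\<Sum>i\<in>UNIV. (x $ i)\<^sup>2 - 2 * (p * (v i * x $ i))) \<le> (\<Sum>i\<in>UNIV. (\<alpha> i)\<^sup>2)"
      proof (rule sum_mono)
        fix i
        have "0 \<le> (p * v i)\<^sup>2" by simp
        then show "(x $ i)\<^sup>2 - 2 * (p * (v i * x $ i)) \<le> (\<alpha> i)\<^sup>2"
          by (simp add: \<alpha>_def power2_diff algebra_simps)
      qed
      ultimately show ?thesis
        by (simp add: norm_sq_sum sum_subtractf sum_distrib_left[symmetric] mult.commute)
    qed
    also have "\<dots> \<le> (\<Sum>i\<in>UNIV. real CARD('j) * (\<Sum>j\<in>UNIV. (\<psi> i j)\<^sup>2))"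
    proof (rule sum_mono)
      show "(\<alpha> i)\<^sup>2 \<le> real CARD('j) * (\<Sum>j\<in>UNIV. (\<psi> i j)\<^sup>2)" for i
        using Cauchy_Schwarz_ineq_sum[of "\<lambda>_. 1" "\<psi> i" UNIV] by (simp add: row)
    qed
    also have "\<dots> = real CARD('j) * N" by (simp add: N_def sum_distrib_left)
    finally have "a * ((norm x)\<^sup>2 - 2 * norm x * \<bar>s\<bar>) \<le> a * (real CARD('j) * N)" using a by simp
    also have "\<dots> = \<kappa> / 2 * N" by (simp add: a_def)
    finally have E: "- (\<kappa> / 2) * N \<le> - a * (norm x)\<^sup>2 + 2 * a * norm x * \<bar>s\<bar>" by (simp add: algebra_simps)
    \<comment> \<open>One factor |s| is traded for |x|, so that the errors quadratic in
      \<open>s\<close> join the mixed ones.\<close>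
    have "s\<^sup>2 \<le> real CARD('i) * norm x * \<bar>s\<bar>"
      using mult_right_mono[OF abs_esum_le[of x], of "\<bar>s\<bar>"]
      by (simp add: s_def power2_eq_square)
    then have F: "(C + K1) * s\<^sup>2 \<le> (C + K1) * (real CARD('i) * norm x * \<bar>s\<bar>)"
      using q K0 by (intro mult_left_mono) auto
    have "q i * x $ i * drift adj \<mu> \<gamma> ell x u $ i =
        - (q i * \<alpha> i * W i) + - (p * v i * q i) * W i + q i * x $ i * (ell i - \<gamma> i * p * v i)" for i
      unfolding b by (simp add: \<alpha>_def algebra_simps)
    then have "(\<Sum>i\<in>UNIV. q i * x $ i * drift adj \<mu> \<gamma> ell x u $ i) =
        - (\<Sum>i\<in>UNIV. q i * \<alpha> i * W i) + (\<Sum>i\<in>UNIV. - (p * v i * q i) * W i)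
        + (\<Sum>i\<in>UNIV. q i * x $ i * (ell i - \<gamma> i * p * v i))"
      by (simp only: sum.distrib sum_negf)
    also have "\<dots> \<le> - (\<kappa> / 2) * N + (C + K1) * s\<^sup>2 + K2 * norm x + K3 * norm x * \<bar>s\<bar>"
      using A B D by (simp add: algebra_simps)
    also have "\<dots> \<le> - a * (norm x)\<^sup>2 + 2 * a * norm x * \<bar>s\<bar>
        + (C + K1) * (real CARD('i) * norm x * \<bar>s\<bar>) + K2 * norm x + K3 * norm x * \<bar>s\<bar>"
      using E F by linarith
    also have "\<dots> = - a * (norm x)\<^sup>2 + (K - K2) * norm x * \<bar>s\<bar> + K2 * norm x"
      by (simp add: K_def algebra_simps)
    also have "\<dots> \<le> - a * (norm x)\<^sup>2 + K * norm x * \<bar>s\<bar> + K * norm x"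
    proof -
      have "K2 \<le> K" unfolding K_def using K0 q a by (simp add: add_nonneg_nonneg)
      then show ?thesis using K0 by (intro add_mono mult_right_mono) auto
    qed
    finally show ?thesis by (simp add: s_def)
  qed
  then show ?thesis using that q(1) a K by blast
qed

subsection \<open>Powers of the norm\<close>

lemma powr_half_square: "0 \<le> t \<Longrightarrow> (t\<^sup>2) powr (m / 2) = t powr m" for t m :: real
  by (cases "t = 0") (simp_all add: powr_def ln_realpow)

text \<open>Gives the boundedness half of all three compactness claims: for \<open>h\<close>, for V,
  and for the minimal cost on the closed cone.\<close>

lemma bounded_norm_powr_le:
  fixes k m c :: real
  assumes "k > 0" "m \<ge> 1"
  shows "bounded {x :: 'a::real_normed_vector. k * norm x powr m \<le> c}"
proof (rule boundedI[of _ "max 1 (c / k)"])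
  fix x :: 'a assume "x \<in> {x. k * norm x powr m \<le> c}"
  then have "norm x powr m \<le> c / k" using assms by (simp add: field_simps)
  moreover have "norm x \<le> norm x powr m" if "norm x \<ge> 1"
    using powr_mono[OF \<open>m \<ge> 1\<close> that] that by simp
  ultimately show "norm x \<le> max 1 (c / k)" by linarith
qed

text \<open>For large \<open>y\<close>, half of \<open>a * y\<close> beats \<open>k\<close>.
  Otherwise \<open>y\<close> is at most \<open>2 * k / a\<close> and the \<open>k\<close>-term is
  bounded outright; \<open>y \<ge> 1\<close> allows raising the exponent p - 1, which is negative
  when m < 2.\<close>

lemma absorb_powr:
  fixes y k a p :: real
  assumes "y \<ge> 1" "k > 0" "a > 0" "p \<ge> 0"
  shows "y powr (p - 1) * (k - a * y) \<le> k * (2 * k / a) powr p - a / 2 * y powr p"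
proof -
  define z where "z = y powr (p - 1)"
  have z: "z \<ge> 0" by (simp add: z_def)
  have yp: "y powr p = z * y" using assms by (simp add: z_def powr_diff)
  show ?thesis
  proof (cases "k \<le> a / 2 * y")
    case True
    then have "z * (k - a * y) \<le> z * (- (a / 2 * y))" using z by (intro mult_left_mono) auto
    moreover have "0 \<le> k * (2 * k / a) powr p" using assms by simp
    ultimately show ?thesis unfolding yp z_def[symmetric] by (simp add: algebra_simps)
  next
    case False
    then have "y \<le> 2 * k / a" using assms by (simp add: field_simps)
    then have "y powr p \<le> (2 * k / a) powr p" using assms by (intro powr_mono2) auto
    moreover have "z \<le> y powr p" unfolding z_def using assms by (intro powr_mono) auto
    ultimately have "k * z \<le> k * (2 * k / a) powr p" using assms by (intro mult_left_mono) auto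
    moreover have "0 \<le> a / 2 * (z * y)" using z assms by simp
    ultimately show ?thesis unfolding yp z_def[symmetric] by (simp add: algebra_simps)
  qed
qed

subsection \<open>The Lyapunov function\<close>

definition wvec :: "('n \<Rightarrow> real) \<Rightarrow> real ^ 'n \<Rightarrow> real ^ 'n" where
  "wvec q x = (\<chi> i. q i * x $ i)"

text \<open>The added 1 keeps the base of the power away from zero, so that V is C^2 at the origin
  for small \<open>m\<close> as well.\<close>

definition wsq :: "('n::finite \<Rightarrow> real) \<Rightarrow> real ^ 'n \<Rightarrow> real" where
  "wsq q x = 1 + wvec q x \<bullet> x"

lemma wsq_eq: "wsq q x = 1 + (\<Sum>i\<in>UNIV. q i * (x $ i)\<^sup>2)"
  by (simp add: wsq_def wvec_def inner_vec_def power2_eq_square mult.assoc)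

lemma wsq_ge_1:
  assumes "\<And>i. q i \<ge> 0"
  shows "wsq q x \<ge> 1"
  unfolding wsq_eq using assms by (simp add: sum_nonneg)

lemma wvec_inner: "wvec q x \<bullet> v = (\<Sum>i\<in>UNIV. q i * x $ i * v $ i)"
  by (simp add: wvec_def inner_vec_def)

lemma bounded_linear_wvec: "bounded_linear (wvec q)"
  by (rule linear_conv_bounded_linear[THEN iffD1], rule linearI)
    (auto simp: wvec_def vec_eq_iff algebra_simps)

lemma has_derivative_wsq:
  "(wsq q has_derivative (\<lambda>v. 2 * (wvec q x \<bullet> v))) (at x)"
proof -
  have "wvec q v \<bullet> x = wvec q x \<bullet> v" for v by (simp add: wvec_inner mult.commute mult.left_commute)
  moreover have "(wvec q has_derivative wvec q) (at x)"
    by (rule bounded_linear_imp_has_derivative[OF bounded_linear_wvec])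
  ultimately show ?thesis
    unfolding wsq_def[abs_def] by (auto intro!: derivative_eq_intros simp: fun_eq_iff)
qed

lemma has_derivative_wsq_powr:
  assumes "\<And>i. q i \<ge> 0"
  shows "((\<lambda>x. wsq q x powr a) has_derivative
    (\<lambda>v. 2 * a * wsq q x powr (a - 1) * (wvec q x \<bullet> v))) (at x)"
proof -
  have "wsq q x > 0" using wsq_ge_1[of q x] assms by simp
  then have "((\<lambda>x. wsq q x powr a) has_derivative
    (\<lambda>v. wsq q x powr a * (0 * ln (wsq q x) + 2 * (wvec q x \<bullet> v) * a / wsq q x))) (at x)"
    by (intro has_derivative_powr has_derivative_wsq has_derivative_const) auto
  then show ?thesis using \<open>wsq q x > 0\<close>
    by (simp add: powr_diff mult_ac)
qed

definition lyap :: "real \<Rightarrow> real \<Rightarrow> ('n::finite \<Rightarrow> real) \<Rightarrow> real ^ 'n \<Rightarrow> real" where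
  "lyap e m q x = e * wsq q x powr (m / 2)"

definition lyap_grad :: "real \<Rightarrow> real \<Rightarrow> ('n::finite \<Rightarrow> real) \<Rightarrow> real ^ 'n \<Rightarrow> real ^ 'n" where
  "lyap_grad e m q x = (e * m * wsq q x powr (m / 2 - 1)) *\<^sub>R wvec q x"

definition lyap_hess :: "real \<Rightarrow> real \<Rightarrow> ('n::finite \<Rightarrow> real) \<Rightarrow> real ^ 'n \<Rightarrow> real ^ 'n ^ 'n" where
  "lyap_hess e m q x = (\<chi> i k. e * m * ((if k = i then wsq q x powr (m / 2 - 1) * q i else 0)
     + (m - 2) * wsq q x powr (m / 2 - 2) * (q i * x $ i) * (q k * x $ k)))"

lemma lyap_C2:
  assumes "\<And>i. q i \<ge> 0"
  shows "C2_with (lyap e m q) (lyap_grad e m q) (lyap_hess e m q)"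
  unfolding C2_with_def
proof (intro conjI allI)
  fix x
  have "((\<lambda>x. e * wsq q x powr (m / 2)) has_derivative
      (\<lambda>v. e * (2 * (m / 2) * wsq q x powr (m / 2 - 1) * (wvec q x \<bullet> v)))) (at x)"
    by (intro has_derivative_mult_right has_derivative_wsq_powr assms)
  then show "(lyap e m q has_derivative (\<lambda>v. lyap_grad e m q x \<bullet> v)) (at x)"
    by (simp add: lyap_def[abs_def] lyap_grad_def mult.assoc)
next
  fix x
  have "((\<lambda>x. (e * m * wsq q x powr (m / 2 - 1)) *\<^sub>R wvec q x) has_derivative
      (\<lambda>v. (e * m * wsq q x powr (m / 2 - 1)) *\<^sub>R wvec q v
        + (e * m * (2 * (m / 2 - 1) * wsq q x powr (m / 2 - 1 - 1) * (wvec q x \<bullet> v))) *\<^sub>R wvec q x)) (at x)"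
    by (intro has_derivative_scaleR has_derivative_mult_right has_derivative_wsq_powr assms
        bounded_linear_imp_has_derivative[OF bounded_linear_wvec])
  also have "(\<lambda>v. (e * m * wsq q x powr (m / 2 - 1)) *\<^sub>R wvec q v
        + (e * m * (2 * (m / 2 - 1) * wsq q x powr (m / 2 - 1 - 1) * (wvec q x \<bullet> v))) *\<^sub>R wvec q x)
      = (\<lambda>v. lyap_hess e m q x *v v)"
  proof (intro ext, subst vec_eq_iff, intro allI)
    fix v i
    have "(lyap_hess e m q x *v v) $ i = (\<Sum>k\<in>UNIV. (if k = i then e * m * (wsq q x powr (m / 2 - 1) * q i) * v $ i else 0)
        + e * m * (m - 2) * wsq q x powr (m / 2 - 2) * (q i * x $ i) * (q k * x $ k * v $ k))"
      unfolding matrix_vector_mult_def lyap_hess_def by (auto intro!: sum.cong simp: algebra_simps)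
    also have "\<dots> = e * m * (wsq q x powr (m / 2 - 1) * q i) * v $ i
        + e * m * (m - 2) * wsq q x powr (m / 2 - 2) * (q i * x $ i) * (wvec q x \<bullet> v)"
      by (simp add: sum.distrib wvec_inner sum_distrib_left)
    finally show "((e * m * wsq q x powr (m / 2 - 1)) *\<^sub>R wvec q v
        + (e * m * (2 * (m / 2 - 1) * wsq q x powr (m / 2 - 1 - 1) * (wvec q x \<bullet> v))) *\<^sub>R wvec q x) $ i
      = (lyap_hess e m q x *v v) $ i"
      by (simp add: wvec_def algebra_simps)
  qed
  finally show "(lyap_grad e m q has_derivative (*v) (lyap_hess e m q x)) (at x)"
    by (simp add: lyap_grad_def[abs_def])
next
  have "wsq q x \<noteq> 0" for x using wsq_ge_1[of q x] assms by force
  moreover have "continuous_on UNIV (wsq q)"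
    unfolding wsq_eq[abs_def] by (intro continuous_intros)
  ultimately have c: "continuous_on UNIV (\<lambda>x. wsq q x powr a)" for a
    by (intro continuous_on_powr continuous_on_const) auto
  have "continuous_on UNIV (\<lambda>x. if k = i then wsq q x powr (m / 2 - 1) * q i else 0)" for i k
    by (cases "k = i") (auto intro!: continuous_intros c)
  then show "continuous_on UNIV (lyap_hess e m q)"
    unfolding lyap_hess_def[abs_def] by (intro continuous_intros c)
qed

text \<open>The Hessian term quadratic in x carries the power m/2 - 2, but q_i x_i^2 \<le>
  \<open>wsq q x\<close> raises it to m/2 - 1. Diffusion thus adds only a constant beside the drift
  term; the absolute value covers m < 2.\<close>

lemma gen_lyap_le:
  assumes q: "\<And>i. q i \<ge> 0" and lam: "\<And>i. lam i \<ge> 0" and "e \<ge> 0" "m \<ge> 0"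
  shows "gen b lam (lyap_grad e m q) (lyap_hess e m q) x u \<le> e * (m * (wsq q x powr (m / 2 - 1) *
    ((1 + \<bar>m - 2\<bar>) * (\<Sum>i\<in>UNIV. lam i * q i) + (\<Sum>i\<in>UNIV. q i * x $ i * b x u $ i))))"
proof -
  define y where "y = wsq q x"
  have y: "y \<ge> 1" unfolding y_def using q by (rule wsq_ge_1)
  define z where "z = y powr (m / 2 - 2)"
  have z: "z \<ge> 0" "y powr (m / 2 - 1) = z * y"
    using y by (simp_all add: z_def powr_diff power2_eq_square)
  define S1 where "S1 = (\<Sum>i\<in>UNIV. lam i * q i)"
  define S2 where "S2 = (\<Sum>i\<in>UNIV. lam i * (q i * x $ i)\<^sup>2)"
  define P where "P = (\<Sum>i\<in>UNIV. q i * x $ i * b x u $ i)"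
  have "gen b lam (lyap_grad e m q) (lyap_hess e m q) x u
      = e * m * (z * y * S1 + (m - 2) * z * S2) + e * m * (z * y) * P"
    by (simp add: gen_def lyap_hess_def lyap_grad_def y_def[symmetric] z z_def[symmetric]
        S1_def S2_def P_def inner_commute[of "b x u"] wvec_inner sum_distrib_left
        power2_eq_square sum.distrib[symmetric] algebra_simps)
  also have "\<dots> = e * (m * (z * (y * S1 + (m - 2) * S2 + y * P)))" by (simp add: algebra_simps)
  also have "\<dots> \<le> e * (m * (z * (y * ((1 + \<bar>m - 2\<bar>) * S1 + P))))"
  proof (intro mult_left_mono)
    have "S2 \<le> (\<Sum>i\<in>UNIV. lam i * q i * y)"
      unfolding S2_def
    proof (rule sum_mono)
      fix i
      have "q i * (x $ i)\<^sup>2 \<le> (\<Sum>i\<in>UNIV. q i * (x $ i)\<^sup>2)"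
        using q by (intro member_le_sum) auto
      then have "q i * (x $ i)\<^sup>2 \<le> y" by (simp add: y_def wsq_eq)
      then have "lam i * q i * (q i * (x $ i)\<^sup>2) \<le> lam i * q i * y"
        using lam q by (intro mult_left_mono) auto
      then show "lam i * (q i * x $ i)\<^sup>2 \<le> lam i * q i * y"
        by (simp add: power_mult_distrib power2_eq_square algebra_simps)
    qed
    then have "S2 \<le> y * S1" by (simp add: S1_def sum_distrib_left mult.commute)
    moreover have "S2 \<ge> 0" unfolding S2_def using lam by (simp add: sum_nonneg)
    ultimately have "(m - 2) * S2 \<le> \<bar>m - 2\<bar> * (y * S1)"
      by (meson abs_ge_self abs_ge_zero mult_mono)
    then show "y * S1 + (m - 2) * S2 + y * P \<le> y * ((1 + \<bar>m - 2\<bar>) * S1 + P)"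
      by (simp add: algebra_simps)
  qed (use z assms in auto)
  finally show ?thesis
    by (simp add: z y_def[symmetric] S1_def P_def algebra_simps)
qed

subsection \<open>The running cost\<close>

lemma cINF_scale:
  fixes f :: "'a \<Rightarrow> real"
  assumes "A \<noteq> {}" "\<And>u. u \<in> A \<Longrightarrow> f u \<ge> 0" "a \<ge> 0"
  shows "(INF u\<in>A. a * f u) = a * (INF u\<in>A. f u)"
proof (cases "a = 0")
  case True
  then show ?thesis using assms by simp
next
  case False
  then have a: "a > 0" using assms by simp
  have bdd: "bdd_below (f ` A)" "bdd_below ((\<lambda>u. a * f u) ` A)"
    using assms by (auto intro!: bdd_belowI2[of _ 0])
  show ?thesis
  proof (rule antisym)
    have "(INF u\<in>A. a * f u) / a \<le> (INF u\<in>A. f u)"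
    proof (rule cINF_greatest[OF assms(1)])
      fix u assume "u \<in> A"
      then have "(INF u\<in>A. a * f u) \<le> a * f u" by (rule cINF_lower[OF bdd(2)])
      then show "(INF u\<in>A. a * f u) / a \<le> f u" using a by (simp add: field_simps)
    qed
    then show "(INF u\<in>A. a * f u) \<le> a * (INF u\<in>A. f u)" using a by (simp add: field_simps)
    show "a * (INF u\<in>A. f u) \<le> (INF u\<in>A. a * f u)"
      using a bdd by (intro cINF_greatest assms mult_left_mono cINF_lower) auto
  qed
qed

lemma Uset_nonempty: "(Uset :: (('i::finite \<Rightarrow> real) \<times> ('j::finite \<Rightarrow> real)) set) \<noteq> {}"
proof -
  obtain i :: 'i and j :: 'j where True by blast
  have "((\<lambda>k. if k = i then 1 else 0), (\<lambda>k. if k = j then 1 else 0)) \<in> Uset"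
    by (simp add: Uset_def)
  then show ?thesis by blast
qed

text \<open>Pigeonhole: some coordinate is at least 1/n, and its term alone gives the bound.\<close>

lemma simplex_powr_sum_ge:
  fixes \<xi> :: "'n::finite \<Rightarrow> real"
  assumes "\<And>i. \<xi> i > 0" "m \<ge> 0"
  obtains c where "c > 0" "\<And>v. (\<And>i. v i \<ge> 0) \<Longrightarrow> (\<Sum>i\<in>UNIV. v i) = 1 \<Longrightarrow> c \<le> (\<Sum>i\<in>UNIV. \<xi> i * v i powr m)"
proof
  let ?n = "real CARD('n)"
  show "Min (range \<xi>) * (1 / ?n) powr m > 0" using assms by simp
  fix v :: "'n \<Rightarrow> real" assume v: "\<And>i. v i \<ge> 0" "(\<Sum>i\<in>UNIV. v i) = 1"
  have "\<exists>i. v i \<ge> 1 / ?n"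
  proof (rule ccontr)
    assume "\<not> ?thesis"
    then have "(\<Sum>i\<in>UNIV. v i) < (\<Sum>i\<in>(UNIV::'n set). 1 / ?n)"
      by (intro sum_strict_mono) (auto simp: not_le)
    then show False using v by simp
  qed
  then obtain i where "v i \<ge> 1 / ?n" ..
  then have "Min (range \<xi>) * (1 / ?n) powr m \<le> \<xi> i * v i powr m"
    using assms less_imp_le[OF assms(1)] by (intro mult_mono powr_mono2) auto
  also have "\<dots> \<le> (\<Sum>i\<in>UNIV. \<xi> i * v i powr m)"
    using less_imp_le[OF assms(1)] by (intro member_le_sum) auto
  finally show "Min (range \<xi>) * (1 / ?n) powr m \<le> (\<Sum>i\<in>UNIV. \<xi> i * v i powr m)" .
qed

text \<open>At most one of the two parts of \<open>esum x\<close> is nonzero, so their m-th powers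
  add up to that of |e.x|.\<close>

lemma cost_ge:
  fixes \<xi> :: "'i::finite \<Rightarrow> real" and \<zeta> :: "'j::finite \<Rightarrow> real"
  assumes "\<And>i. \<xi> i > 0" "\<And>j. \<zeta> j > 0" "m > 0"
  obtains c where "c > 0" "\<And>x u. u \<in> Uset \<Longrightarrow> c * \<bar>esum x\<bar> powr m \<le> cost m \<xi> \<zeta> x u"
proof -
  obtain c1 where c1: "c1 > 0" "\<And>v. (\<And>i. v i \<ge> 0) \<Longrightarrow> (\<Sum>i\<in>UNIV. v i) = 1 \<Longrightarrow> c1 \<le> (\<Sum>i\<in>UNIV. \<xi> i * v i powr m)"
    using simplex_powr_sum_ge[of \<xi> m] assms by auto
  obtain c2 where c2: "c2 > 0" "\<And>v. (\<And>i. v i \<ge> 0) \<Longrightarrow> (\<Sum>i\<in>UNIV. v i) = 1 \<Longrightarrow> c2 \<le> (\<Sum>i\<in>UNIV. \<zeta> i * v i powr m)"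
    using simplex_powr_sum_ge[of \<zeta> m] assms by auto
  have "min c1 c2 * \<bar>esum x\<bar> powr m \<le> cost m \<xi> \<zeta> x u" if u: "u \<in> Uset" for x u
  proof -
    have "min c1 c2 \<le> (\<Sum>i\<in>UNIV. \<xi> i * fst u i powr m)"
      using c1(2)[of "fst u"] u by (auto simp: Uset_def)
    moreover have "min c1 c2 \<le> (\<Sum>i\<in>UNIV. \<zeta> i * snd u i powr m)"
      using c2(2)[of "snd u"] u by (auto simp: Uset_def)
    ultimately have "pospart (esum x) powr m * min c1 c2 + negpart (esum x) powr m * min c1 c2 \<le> cost m \<xi> \<zeta> x u"
      unfolding cost_def by (intro add_mono mult_left_mono) auto
    moreover have "pospart (esum x) powr m + negpart (esum x) powr m = \<bar>esum x\<bar> powr m"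
      by (auto simp: pospart_def negpart_def max_def)
    ultimately show ?thesis by (metis distrib_right mult.commute)
  qed
  then show ?thesis using that[of "min c1 c2"] c1 c2 by auto
qed

(* One of the two parts of esum x vanishes, so the infimum splits with no joint optimisation;
   this makes it continuous in x. *)
lemma INF_cost_eq:
  fixes \<xi> :: "'i::finite \<Rightarrow> real" and \<zeta> :: "'j::finite \<Rightarrow> real"
  assumes "\<And>i. \<xi> i \<ge> 0" "\<And>j. \<zeta> j \<ge> 0"
  shows "(INF u\<in>Uset. cost m \<xi> \<zeta> x u) =
      pospart (esum x) powr m * (INF u\<in>(Uset :: (('i \<Rightarrow> real) \<times> ('j \<Rightarrow> real)) set). \<Sum>i\<in>UNIV. \<xi> i * fst u i powr m)
    + negpart (esum x) powr m * (INF u\<in>(Uset :: (('i \<Rightarrow> real) \<times> ('j \<Rightarrow> real)) set). \<Sum>j\<in>UNIV. \<zeta> j * snd u j powr m)"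
proof (cases "esum x \<ge> 0")
  case True
  then have "negpart (esum x) = 0" by (simp add: negpart_def)
  then show ?thesis unfolding cost_def
    using assms by (simp add: cINF_scale[OF Uset_nonempty] sum_nonneg)
next
  case False
  then have "pospart (esum x) = 0" by (simp add: pospart_def)
  then show ?thesis unfolding cost_def
    using assms by (simp add: cINF_scale[OF Uset_nonempty] sum_nonneg)
qed

subsection \<open>Hypothesis A\<close>

theorem mainTheorem6:
  fixes adj :: "'i::finite \<Rightarrow> 'j::finite \<Rightarrow> bool"
    and lam \<gamma> ell :: "'i \<Rightarrow> real"
    and \<mu> :: "'i \<Rightarrow> 'j \<Rightarrow> real"
    and \<xi> :: "'i \<Rightarrow> real" and \<zeta> :: "'j \<Rightarrow> real"
    and m :: real
  assumes tree: "bip_tree adj"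
    and lam_pos: "\<forall>i. lam i > 0"
    and gam_nonneg: "\<forall>i. \<gamma> i \<ge> 0"
    and mu_pos: "\<forall>i j. adj i j \<longrightarrow> \<mu> i j > 0"
    and mu_zero: "\<forall>i j. \<not> adj i j \<longrightarrow> \<mu> i j = 0"
    and m_ge: "m \<ge> 1"
    and xi_pos: "\<forall>i. \<xi> i > 0"
    and zeta_pos: "\<forall>j. \<zeta> j > 0"
  shows "\<exists>\<delta>>0. \<exists>C>0. hypA (drift adj \<mu> \<gamma> ell) lam (cost m \<xi> \<zeta>)
            {x. \<bar>esum x\<bar> > \<delta> * norm x} (\<lambda>x u. C * norm x powr m)"
proof -
  let ?b = "drift adj \<mu> \<gamma> ell"
  have m0: "m > 0" using m_ge by simp
  obtain q a K where q: "\<And>i. q i > 0" and a: "a > 0" and K: "K \<ge> 0"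
    and drift: "\<And>x u. u \<in> Uset \<Longrightarrow> (\<Sum>i\<in>UNIV. q i * x $ i * ?b x u $ i)
       \<le> - a * (norm x)\<^sup>2 + K * norm x * \<bar>esum x\<bar> + K * norm x"
    using drift_dissipative[OF tree, of \<mu> \<gamma> ell] mu_pos gam_nonneg by blast
  have q0: "q i \<ge> 0" for i using q less_imp_le by blast
  have lam0: "lam i \<ge> 0" for i using lam_pos less_imp_le by blast
  obtain c1 where c1: "c1 > 0" and cost_ge: "\<And>x u. u \<in> Uset \<Longrightarrow> c1 * \<bar>esum x\<bar> powr m \<le> cost m \<xi> \<zeta> x u"
    using cost_ge[of \<xi> \<zeta> m] xi_pos zeta_pos m0 by blast
  define q1 q2 where "q1 = Min (range q)" and "q2 = Max (range q)"
  have q12: "q1 > 0" "q1 \<le> q i" "q i \<le> q2" for i using q by (auto simp: q1_def q2_def)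
  then have q2: "q2 > 0" by (meson less_le_trans)
  define y where "y = wsq q"
  have y: "y x \<ge> 1" for x unfolding y_def by (rule wsq_ge_1[OF q0])
  have y_ge: "1 + q1 * (norm x)\<^sup>2 \<le> y x" for x
    unfolding y_def wsq_eq norm_sq_sum sum_distrib_left
    by (intro add_left_mono sum_mono mult_right_mono q12) auto
  have y_le: "y x \<le> 1 + q2 * (norm x)\<^sup>2" for x
    unfolding y_def wsq_eq norm_sq_sum sum_distrib_left
    by (intro add_left_mono sum_mono mult_right_mono q12) auto
  have ym_ge: "q1 powr (m / 2) * norm x powr m \<le> y x powr (m / 2)" for x
  proof -
    have "(q1 * (norm x)\<^sup>2) powr (m / 2) \<le> y x powr (m / 2)"
      using y_ge[of x] m0 q12 by (intro powr_mono2) auto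
    then show ?thesis using q12 by (simp add: powr_mult powr_half_square)
  qed
  have ym_le: "y x powr (m / 2) \<le> (2 * (1 + q2)) powr (m / 2) * (1 + norm x powr m)" for x
  proof -
    \<comment> \<open>Replacing |x|^2 by its maximum with 1 turns a sum into a product, to which
      \<open>powr_mult\<close> applies.\<close>
    define Z where "Z = max 1 ((norm x)\<^sup>2)"
    have "q2 * (norm x)\<^sup>2 \<le> q2 * Z" using q2 by (simp add: Z_def)
    moreover have "Z \<ge> 1" "q2 * Z \<ge> 0" using q2 by (auto simp: Z_def)
    ultimately have "y x \<le> 2 * Z + 2 * (q2 * Z)" using y_le[of x] by linarith
    then have "y x \<le> 2 * (1 + q2) * max 1 ((norm x)\<^sup>2)"
      unfolding Z_def by (simp add: algebra_simps)
    then have "y x powr (m / 2) \<le> (2 * (1 + q2) * max 1 ((norm x)\<^sup>2)) powr (m / 2)"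
      using y[of x] m0 by (intro powr_mono2) auto
    also have "\<dots> = (2 * (1 + q2)) powr (m / 2) * max 1 ((norm x)\<^sup>2) powr (m / 2)"
      by (rule powr_mult)
    also have "\<dots> \<le> (2 * (1 + q2)) powr (m / 2) * (1 + norm x powr m)"
      by (intro mult_left_mono) (auto simp: max_def powr_half_square)
    finally show ?thesis .
  qed
  \<comment> \<open>Off the cone the mixed term then eats at most half of the dissipation
    \<open>a\<close>. Using \<open>K + 1\<close> avoids division by zero.\<close>
  define \<delta> where "\<delta> = a / (2 * (K + 1))"
  have \<delta>: "\<delta> > 0" "K * \<delta> \<le> a / 2" using a K by (auto simp: \<delta>_def field_simps)
  define \<Lambda> where "\<Lambda> = (1 + \<bar>m - 2\<bar>) * (\<Sum>i\<in>UNIV. lam i * q i)"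
  have \<Lambda>: "\<Lambda> \<ge> 0" unfolding \<Lambda>_def using lam0 q0 by (simp add: sum_nonneg)
  define P where "P x u = (\<Sum>i\<in>UNIV. q i * x $ i * ?b x u $ i)" for x u
  have gen: "gen ?b lam (lyap_grad e m q) (lyap_hess e m q) x u
      \<le> e * (m * (y x powr (m / 2 - 1) * (\<Lambda> + P x u)))" if "e \<ge> 0" for e x u
    unfolding y_def \<Lambda>_def P_def by (rule gen_lyap_le) (use q0 lam0 that m0 in auto)

  \<comment> \<open>Of the remaining \<open>a / 2\<close>, one half absorbs
    \<open>K * norm x\<close> by AM-GM at the price \<open>K\<^sup>2 / a\<close>; the other
    \<open>a / 4\<close> is rewritten through \<open>y x - 1 \<le> q2 * (norm x)\<^sup>2\<close>,
    whose -1 puts \<open>a4\<close> into \<open>K4\<close>.\<close>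
  define a4 where "a4 = a / (4 * q2)"
  define K4 where "K4 = \<Lambda> + K\<^sup>2 / a + a4"
  have a4: "a4 > 0" using a q2 by (simp add: a4_def)
  have K4: "K4 > 0" unfolding K4_def using \<Lambda> a a4 by (simp add: add_nonneg_pos)
  \<comment> \<open>\<open>K5\<close> and \<open>c2\<close> are the output of
    \<open>absorb_powr\<close> with exponent m/2, times \<open>m\<close>; the power of
    \<open>q1\<close> converts \<open>y\<close> back to the norm.\<close>
  define K5 where "K5 = m * (K4 * (2 * K4 / a4) powr (m / 2))"
  define c2 where "c2 = m * (a4 / 2 * q1 powr (m / 2))"
  have K5: "K5 \<ge> 0" using m0 K4 by (simp add: K5_def)
  have c2: "c2 > 0" using m0 a4 q12 by (simp add: c2_def)
  have outside: "m * (y x powr (m / 2 - 1) * (\<Lambda> + P x u)) \<le> K5 - c2 * norm x powr m"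
    if "\<bar>esum x\<bar> \<le> \<delta> * norm x" "u \<in> Uset" for x u
  proof -
    have "K * norm x * \<bar>esum x\<bar> \<le> K * norm x * (\<delta> * norm x)"
      using that K by (intro mult_left_mono) auto
    also have "\<dots> = K * \<delta> * (norm x)\<^sup>2" by (simp add: power2_eq_square)
    also have "\<dots> \<le> a / 2 * (norm x)\<^sup>2" using \<delta> by (intro mult_right_mono) auto
    finally have "P x u \<le> - (a / 2) * (norm x)\<^sup>2 + K * norm x"
      using drift[OF that(2), of x] by (simp add: P_def)
    moreover have "K * norm x \<le> a / 4 * (norm x)\<^sup>2 + K\<^sup>2 / a"
      using AM_GM_weighted[of "a / 4" "norm x" K] a K by (simp add: abs_mult mult.commute)
    ultimately have "\<Lambda> + P x u \<le> \<Lambda> + K\<^sup>2 / a - a / 4 * (norm x)\<^sup>2" by simp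
    also have "a / 4 * (norm x)\<^sup>2 = a4 * (q2 * (norm x)\<^sup>2)" using q2 by (simp add: a4_def)
    also have "\<Lambda> + K\<^sup>2 / a - a4 * (q2 * (norm x)\<^sup>2) \<le> \<Lambda> + K\<^sup>2 / a - a4 * (y x - 1)"
      using a4 y_le[of x] by (intro diff_left_mono mult_left_mono) auto
    also have "\<dots> = K4 - a4 * y x" by (simp add: K4_def algebra_simps)
    finally have "m * (y x powr (m / 2 - 1) * (\<Lambda> + P x u))
        \<le> m * (y x powr (m / 2 - 1) * (K4 - a4 * y x))"
      using m0 by (intro mult_left_mono) auto
    also have "\<dots> \<le> m * (K4 * (2 * K4 / a4) powr (m / 2) - a4 / 2 * y x powr (m / 2))"
      using m0 y K4 a4 by (intro mult_left_mono absorb_powr) auto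
    also have "\<dots> \<le> m * (K4 * (2 * K4 / a4) powr (m / 2) - a4 / 2 * (q1 powr (m / 2) * norm x powr m))"
      using m0 a4 ym_ge[of x] by (intro mult_left_mono diff_left_mono) auto
    also have "\<dots> = K5 - c2 * norm x powr m" by (simp add: K5_def c2_def algebra_simps)
    finally show ?thesis .
  qed

  \<comment> \<open>Inside the cone only growth matters: the negative drift term is discarded, and 1
    + |x|^2 \<le> (1 + 1/q1) y.\<close>
  define K6 where "K6 = \<Lambda> + K * (real CARD('i) + 1) * (1 + 1 / q1)"
  define K7 where "K7 = m * (K6 * (2 * (1 + q2)) powr (m / 2))"
  have K6: "K6 \<ge> 0" unfolding K6_def using \<Lambda> K q12 by simp
  then have K7: "K7 \<ge> 0" using m0 by (simp add: K7_def)
  have everywhere: "m * (y x powr (m / 2 - 1) * (\<Lambda> + P x u)) \<le> K7 * (1 + norm x powr m)"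
    if "u \<in> Uset" for x u
  proof -
    have "P x u \<le> K * norm x * \<bar>esum x\<bar> + K * norm x"
      using drift[OF that, of x] a by (simp add: P_def) (smt (verit) mult_nonneg_nonneg zero_le_power2)
    also have "\<dots> \<le> K * norm x * (real CARD('i) * norm x) + K * (1 + (norm x)\<^sup>2)"
    proof (intro add_mono mult_left_mono abs_esum_le)
      have "0 \<le> (norm x - 1)\<^sup>2" by simp
      then have "2 * norm x \<le> 1 + (norm x)\<^sup>2" by (simp add: power2_diff)
      then show "norm x \<le> 1 + (norm x)\<^sup>2" using norm_ge_zero[of x] by linarith
    qed (use K in auto)
    also have "\<dots> \<le> K * (real CARD('i) + 1) * (1 + (norm x)\<^sup>2)"
      using K by (simp add: power2_eq_square algebra_simps)
    also have "\<dots> \<le> K * (real CARD('i) + 1) * ((1 + 1 / q1) * y x)"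
    proof (intro mult_left_mono)
      have "(norm x)\<^sup>2 \<le> y x / q1" using y_ge[of x] q12 by (simp add: field_simps)
      then show "1 + (norm x)\<^sup>2 \<le> (1 + 1 / q1) * y x" using y[of x] by (simp add: algebra_simps)
    qed (use K in auto)
    finally have "\<Lambda> + P x u \<le> K6 * y x"
      using mult_left_mono[OF y[of x] \<Lambda>] by (simp add: K6_def algebra_simps)
    then have "m * (y x powr (m / 2 - 1) * (\<Lambda> + P x u)) \<le> m * (y x powr (m / 2 - 1) * (K6 * y x))"
      using m0 by (intro mult_left_mono) auto
    also have "\<dots> = m * (K6 * y x powr (m / 2))" using y[of x] by (simp add: powr_diff)
    also have "\<dots> \<le> m * (K6 * ((2 * (1 + q2)) powr (m / 2) * (1 + norm x powr m)))"
      using m0 K6 by (intro mult_left_mono ym_le) auto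
    also have "\<dots> = K7 * (1 + norm x powr m)" by (simp add: K7_def)
    finally show ?thesis .
  qed

  define r0 where "r0 = c1 * \<delta> powr m"
  have r0: "r0 > 0" using c1 \<delta> by (simp add: r0_def)
  have cost_cone: "r0 * norm x powr m \<le> c1 * \<bar>esum x\<bar> powr m" if "\<delta> * norm x \<le> \<bar>esum x\<bar>" for x :: "real ^ 'i"
  proof -
    have "(\<delta> * norm x) powr m \<le> \<bar>esum x\<bar> powr m" using that \<delta> m0 by (intro powr_mono2) auto
    then show ?thesis using c1 \<delta> by (simp add: r0_def powr_mult)
  qed
  \<comment> \<open>\<open>e = 1 / E\<close> meets three demands at once:
    \<open>e * K5 \<le> 1\<close> off the cone, and \<open>e * K7 \<le> 1\<close> together with
    \<open>e * K7 \<le> r0\<close> on it.\<close>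
  define E where "E = 1 + K5 + K7 + K7 / r0"
  have E: "E > 0" unfolding E_def using K5 K7 r0 by (simp add: add_pos_nonneg)
  define e where "e = 1 / E"
  have e: "e > 0" using E by (simp add: e_def)
  have le1: "e * t \<le> 1" if "t \<le> E" for t using that E by (simp add: e_def)
  have "K7 / r0 \<ge> 0" using K7 r0 by simp
  then have e_le: "e * K5 \<le> 1" "e * K7 \<le> 1" "e * (K7 / r0) \<le> 1"
    using K5 K7 by (intro le1, simp add: E_def)+
  have e_r0: "e * K7 \<le> r0" using e_le(3) r0 by (simp add: field_simps)
  have e_c2: "e * c2 > 0" using e c2 by simp

  have esum_cont: "continuous_on UNIV (esum :: real ^ 'i \<Rightarrow> real)"
    unfolding esum_def[abs_def] by (intro continuous_intros)
  let ?K = "{x :: real ^ 'i. \<delta> * norm x < \<bar>esum x\<bar>}"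
  have "hypA ?b lam (cost m \<xi> \<zeta>) ?K (\<lambda>x u. e * c2 * norm x powr m)"
    unfolding hypA_def
  proof (intro conjI allI)
    show "open ?K" by (intro open_Collect_less continuous_intros esum_cont)
    fix c :: real
    define INFr where "INFr x = (INF u\<in>Uset. cost m \<xi> \<zeta> x u)" for x
    \<comment> \<open>Compactness is asked on the closure, which is why \<open>cost_cone\<close>
      assumes the non-strict inequality.\<close>
    have K_closure: "closure ?K \<subseteq> {x. \<delta> * norm x \<le> \<bar>esum x\<bar>}"
      by (intro closure_minimal closed_Collect_le continuous_intros esum_cont) auto
    have "r0 * norm x powr m \<le> c" if "x \<in> closure ?K" "INFr x \<le> c" for x
    proof -
      have "r0 * norm x powr m \<le> c1 * \<bar>esum x\<bar> powr m" using K_closure that by (intro cost_cone) auto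
      also have "\<dots> \<le> INFr x" unfolding INFr_def by (intro cINF_greatest Uset_nonempty cost_ge)
      finally show ?thesis using that by simp
    qed
    then have "bounded (closure ?K \<inter> {x. INFr x \<le> c})"
      by (intro bounded_subset[OF bounded_norm_powr_le[OF r0 m_ge, of c]]) auto
    \<comment> \<open>Continuity gives closed sublevel sets. The bases of the powers vanish on
      half-spaces, where continuity of \<open>powr\<close> rests on the positive exponent.\<close>
    moreover have "continuous_on UNIV INFr"
    proof -
      have "continuous_on UNIV (\<lambda>x::real^'i. pospart (esum x) powr m)"
        "continuous_on UNIV (\<lambda>x::real^'i. negpart (esum x) powr m)"
        unfolding pospart_def negpart_def
        by (intro continuous_on_powr' continuous_on_max continuous_on_minus esum_cont
            continuous_on_const; use m0 in auto)+
      then show ?thesis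
        unfolding INFr_def[abs_def] using xi_pos zeta_pos
        by (subst INF_cost_eq) (auto intro!: continuous_intros less_imp_le)
    qed
    then have "closed (closure ?K \<inter> {x. INFr x \<le> c})"
      by (intro closed_Int closed_closure closed_Collect_le continuous_on_const)
    ultimately show "compact (closure ?K \<inter> {x. (INF u\<in>Uset. cost m \<xi> \<zeta> x u) \<le> c})"
      by (simp add: compact_eq_bounded_closed INFr_def)
  next
    have norm_cont: "continuous_on A (\<lambda>x::real^'i. norm x powr m)" for A
      by (intro continuous_on_powr' continuous_on_norm continuous_on_id continuous_on_const)
        (use m0 in auto)
    let ?g = "lyap_grad e m q" and ?H = "lyap_hess e m q"
    have C2: "C2_with (lyap e m q) ?g ?H" by (rule lyap_C2[OF q0])
    have nonneg: "\<forall>x. lyap e m q x \<ge> 0" using e by (simp add: lyap_def)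
    have h_nonneg: "\<forall>x u. u \<in> (Uset :: (('i \<Rightarrow> real) \<times> ('j \<Rightarrow> real)) set) \<longrightarrow> 0 \<le> e * c2 * norm (x :: real ^ 'i) powr m"
      using e_c2 by (simp add: less_imp_le)
    have h_cont: "continuous_on (UNIV \<times> (Uset :: (('i \<Rightarrow> real) \<times> ('j \<Rightarrow> real)) set))
        (\<lambda>(x :: real ^ 'i, u). e * c2 * norm x powr m)"
      unfolding case_prod_unfold
      by (intro continuous_on_mult continuous_on_powr' continuous_on_norm continuous_on_fst
          continuous_on_id continuous_on_const) (use m0 in auto)
    \<comment> \<open>\<open>h\<close> is constant in the control, so its infimum over the nonempty
      \<open>Uset\<close> is its own value.\<close>
    have h_compact: "compact {x :: real ^ 'i. (INF u\<in>(Uset :: (('i \<Rightarrow> real) \<times> ('j \<Rightarrow> real)) set).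
        e * c2 * norm x powr m) \<le> c}" for c
      using bounded_norm_powr_le[OF e_c2 m_ge, of c, where 'a = "real ^ 'i"]
      by (simp add: Uset_nonempty compact_eq_bounded_closed)
        (intro closed_Collect_le continuous_intros norm_cont)
    have V_compact: "compact {x. lyap e m q x \<le> c}" for c
    proof -
      have "continuous_on UNIV (lyap e m q)"
        using C2 unfolding C2_with_def continuous_on_eq_continuous_within
        by (auto intro: has_derivative_continuous)
      then have "closed {x. lyap e m q x \<le> c}" by (intro closed_Collect_le continuous_on_const)
      moreover have "e * q1 powr (m / 2) * norm x powr m \<le> lyap e m q x" for x
        using ym_ge[of x] e by (simp add: lyap_def y_def mult.assoc)
      then have "{x. lyap e m q x \<le> c} \<subseteq> {x. e * q1 powr (m / 2) * norm x powr m \<le> c}"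
        using order_trans by blast
      then have "bounded {x. lyap e m q x \<le> c}"
        using e q12 by (intro bounded_subset[OF bounded_norm_powr_le[OF _ m_ge]]) auto
      ultimately show ?thesis by (simp add: compact_eq_bounded_closed)
    qed
    have out: "\<forall>x u. x \<notin> ?K \<longrightarrow> u \<in> Uset \<longrightarrow> gen ?b lam ?g ?H x u \<le> 1 - e * c2 * norm x powr m"
    proof (intro allI impI)
      fix x :: "real ^ 'i" and u :: "('i \<Rightarrow> real) \<times> ('j \<Rightarrow> real)"
      assume "x \<notin> ?K" "u \<in> Uset"
      then have "e * (m * (y x powr (m / 2 - 1) * (\<Lambda> + P x u))) \<le> e * (K5 - c2 * norm x powr m)"
        using e by (intro mult_left_mono outside) auto
      with gen[of e x u] e have "gen ?b lam ?g ?H x u \<le> e * (K5 - c2 * norm x powr m)" by linarith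
      then show "gen ?b lam ?g ?H x u \<le> 1 - e * c2 * norm x powr m"
        using e_le by (simp add: algebra_simps)
    qed
    have ins: "\<forall>x u. x \<in> ?K \<longrightarrow> u \<in> Uset \<longrightarrow> gen ?b lam ?g ?H x u \<le> 1 + cost m \<xi> \<zeta> x u"
    proof (intro allI impI)
      fix x :: "real ^ 'i" and u :: "('i \<Rightarrow> real) \<times> ('j \<Rightarrow> real)"
      assume x: "x \<in> ?K" and u: "u \<in> Uset"
      have "e * (m * (y x powr (m / 2 - 1) * (\<Lambda> + P x u))) \<le> e * (K7 * (1 + norm x powr m))"
        using e u by (intro mult_left_mono everywhere) auto
      with gen[of e x u] e have "gen ?b lam ?g ?H x u \<le> e * (K7 * (1 + norm x powr m))" by linarith
      also have "\<dots> = e * K7 + e * K7 * norm x powr m" by (simp add: algebra_simps)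
      also have "\<dots> \<le> 1 + r0 * norm x powr m"
        using e_le e_r0 by (intro add_mono mult_right_mono) auto
      also have "\<dots> \<le> 1 + cost m \<xi> \<zeta> x u"
        using cost_cone[of x] cost_ge[OF u, of x] x by simp
      finally show "gen ?b lam ?g ?H x u \<le> 1 + cost m \<xi> \<zeta> x u" .
    qed
    show "\<exists>V g H. C2_with V g H \<and> (\<forall>x. 0 \<le> V x)
       \<and> (\<forall>x u. u \<in> (Uset :: (('i \<Rightarrow> real) \<times> ('j \<Rightarrow> real)) set) \<longrightarrow> 0 \<le> e * c2 * norm (x :: real ^ 'i) powr m)
       \<and> continuous_on (UNIV \<times> (Uset :: (('i \<Rightarrow> real) \<times> ('j \<Rightarrow> real)) set)) (\<lambda>(x :: real ^ 'i, u). e * c2 * norm x powr m)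
       \<and> (\<forall>c. compact {x :: real ^ 'i. (INF u\<in>(Uset :: (('i \<Rightarrow> real) \<times> ('j \<Rightarrow> real)) set). e * c2 * norm x powr m) \<le> c})
       \<and> (\<forall>c. compact {x. V x \<le> c})
       \<and> (\<forall>x u. x \<notin> ?K \<longrightarrow> u \<in> Uset \<longrightarrow> gen ?b lam g H x u \<le> 1 - e * c2 * norm x powr m)
       \<and> (\<forall>x u. x \<in> ?K \<longrightarrow> u \<in> Uset \<longrightarrow> gen ?b lam g H x u \<le> 1 + cost m \<xi> \<zeta> x u)"
      using C2 nonneg h_nonneg h_cont h_compact V_compact out ins by blast
  qed
  then show ?thesis using \<delta> e_c2 by blast
qed

end
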